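(* Let $d\ge 3$ and $k\ge3$ be integers with $(d,k)\neq(3,4)$, and let $C_k$ be the cycle of length $k$. Then the ortho-homomorphism density $t(C_k,d)$ is finite.
   Context: For these values of $(d,k)$, $C_k$ is $d$-sparse (it contains no subgraph $K_{a,b}$ with $a,b\ge1$, $a+b>d$). $S^{d-1}$ is the unit sphere of $\mathbb{R}^d$, $A_k$ the surface area of $S^k\subset\mathbb{R}^{k+1}$, and $\mathrm{Det}(y_1,\dots,y_m)=\sqrt{\det((y_i^{\top}y_j)_{i,j})}$ ($=1$ for the empty family). For a $d$-sparse graph $G=(V,E)$ and an ordering $p:V\to\{1,\dots,|V|\}$, let $N_p(v)=\{w:vw\in E,\ p(w)<p(v)\}$, $d_p(v)=|N_p(v)|$, $x_p(v)=(x_w:w\in N_p(v))$, and let $\rho_p$ be the distribution on $(S^{d-1})^V$ of the random sequential ortho-homomorphism (process nodes in increasing $p$, choosing $x_v$ uniformly on the sphere $\{y\in S^{d-1}:y\perp x_w\ \forall w\in N_p(v)\}$). Then $t(G,d)=\int\frac{A_{d-1}^{|E|-|V|}}{A_{d-2}^{|E|}}\prod_{v\in V}\frac{A_{d-d_p(v)-1}}{\mathrm{Det}(x_p(v))}\,d\rho_p(x)\in(0,\infty]$, independent of $p$. *)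

theory Defs
  imports "HOL-Probability.Probability"
begin

text \<open>Surface area A_k of the unit sphere S^k in R^(k+1).\<close>
definition sphere_area :: "nat \<Rightarrow> real" where
  "sphere_area k = 2 * pi powr ((real k + 1) / 2) / Gamma ((real k + 1) / 2)"

text \<open>Determinant of the Gram matrix of the family (y i) indexed by the finite set N
  (Leibniz formula); equals 1 for the empty family.\<close>
definition gram_det :: "'b set \<Rightarrow> ('b \<Rightarrow> 'a::real_inner) \<Rightarrow> real" where
  "gram_det N y = (\<Sum>\<sigma>\<in>{\<sigma>. \<sigma> permutes N}.
       of_int (sign \<sigma>) * (\<Prod>i\<in>N. inner (y i) (y (\<sigma> i))))"

definition Det :: "'b set \<Rightarrow> ('b \<Rightarrow> 'a::real_inner) \<Rightarrow> real" where
  "Det N y = sqrt (gram_det N y)"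

definition perp_proj :: "'a::euclidean_space set \<Rightarrow> 'a \<Rightarrow> 'a" where
  "perp_proj S y = (THE z. (\<forall>s\<in>S. inner z s = 0) \<and> y - z \<in> span S)"

definition std_gauss :: "'a::euclidean_space measure" where
  "std_gauss = density lborel
     (\<lambda>x. ennreal ((2 * pi) powr (- real DIM('a) / 2) * exp (- (norm x)\<^sup>2 / 2)))"

text \<open>Graphs: vertex set {0..<n}, symmetric edge relation E.
  Orderings p are bijections {0..<n} -> {1..n}.\<close>
definition num_edges :: "nat \<Rightarrow> (nat \<Rightarrow> nat \<Rightarrow> bool) \<Rightarrow> nat" where
  "num_edges n E = card {{i, j} | i j. i < n \<and> j < n \<and> E i j}"

definition back_nbrs :: "nat \<Rightarrow> (nat \<Rightarrow> nat \<Rightarrow> bool) \<Rightarrow> (nat \<Rightarrow> nat) \<Rightarrow> nat \<Rightarrow> nat set" where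
  "back_nbrs n E p v = {w \<in> {0..<n}. E v w \<and> p w < p v}"

text \<open>Random sequential ortho-homomorphism, driven by independent standard Gaussian
  vectors g v: at step m the vertex u with p u = m gets
  x_u = normalised projection of g u onto the orthogonal complement of the span of
  its already placed neighbours, which is uniform on the unit sphere of that complement.\<close>
fun seq_ortho :: "nat \<Rightarrow> (nat \<Rightarrow> nat \<Rightarrow> bool) \<Rightarrow> (nat \<Rightarrow> nat) \<Rightarrow> (nat \<Rightarrow> 'a::euclidean_space)
    \<Rightarrow> nat \<Rightarrow> (nat \<Rightarrow> 'a)" where
  "seq_ortho n E p g 0 = (\<lambda>_. 0)"
| "seq_ortho n E p g (Suc m) =
     (let X = seq_ortho n E p g m; u = inv_into {0..<n} p (Suc m)
      in X(u := sgn (perp_proj (X ` back_nbrs n E p u) (g u))))"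

definition rho :: "'a::euclidean_space itself \<Rightarrow> nat \<Rightarrow> (nat \<Rightarrow> nat \<Rightarrow> bool) \<Rightarrow> (nat \<Rightarrow> nat)
    \<Rightarrow> (nat \<Rightarrow> 'a) measure" where
  "rho _ n E p = distr (PiM {0..<n} (\<lambda>_. std_gauss)) (PiM {0..<n} (\<lambda>_. borel))
      (\<lambda>g. restrict (seq_ortho n E p g n) {0..<n})"

definition ortho_density_ord :: "'a::euclidean_space itself \<Rightarrow> nat \<Rightarrow> (nat \<Rightarrow> nat \<Rightarrow> bool)
    \<Rightarrow> (nat \<Rightarrow> nat) \<Rightarrow> ennreal" where
  "ortho_density_ord T n E p =
     (let d = DIM('a) in
      \<integral>\<^sup>+ x. ennreal (sphere_area (d - 1) powr (real (num_edges n E) - real n)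
                     / sphere_area (d - 2) ^ num_edges n E)
           * (\<Prod>v\<in>{0..<n}. ennreal (sphere_area (d - card (back_nbrs n E p v) - 1))
                              / ennreal (Det (back_nbrs n E p v) x))
        \<partial>(rho T n E p))"

text \<open>t(G,d), computed with the ordering p v = v + 1 (the value is independent of p).\<close>
definition ortho_density :: "'a::euclidean_space itself \<Rightarrow> nat \<Rightarrow> (nat \<Rightarrow> nat \<Rightarrow> bool) \<Rightarrow> ennreal" where
  "ortho_density T n E = ortho_density_ord T n E Suc"

definition cycle_graph :: "nat \<Rightarrow> nat \<Rightarrow> nat \<Rightarrow> bool" where
  "cycle_graph k i j \<longleftrightarrow> i < k \<and> j < k \<and> (j = (i + 1) mod k \<or> i = (j + 1) mod k)"

end

theory Submission
  imports Defs
begin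

text \<open>
  Along the ordering \<open>0, 1, \<dots>, k - 1\<close> every vertex of the cycle except the last one has at most
  one earlier neighbour, so almost surely the only determinant different from 1 is
  \<open>sqrt (1 - (x\<^sub>0 \<bullet> x\<^sub>m)\<^sup>2)\<close> with \<open>m = k - 2\<close>, where \<open>x\<^sub>0, x\<^sub>1, \<dots>\<close> is a random walk
  each of whose steps is uniform on the unit sphere orthogonal to the previous position. One has to bound
  the expectation of its inverse.

  Condition on \<open>y = x\<^sub>0\<close> and \<open>z = x\<^sub>m\<^sub>-\<^sub>1\<close>, write \<open>y = c z + s w\<close> with \<open>w\<close> a unit vector orthogonal
  to \<open>z\<close>, and let \<open>h\<close> be the Gaussian vector that drives the step to \<open>x\<^sub>m\<close>. In dimension at least
  4 there are two orthonormal directions \<open>v, u\<close> orthogonal to \<open>z\<close> and \<open>w\<close>, and the inverse sine is at most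
  \<open>norm h / sqrt (\<bar>v \<bullet> h\<bar> * \<bar>u \<bullet> h\<bar>)\<close>, which has finite expectation. In dimension 3 only
  \<open>v\<close> is available, but using \<open>w\<close> in place of \<open>u\<close> costs no more than a factor \<open>1 / sqrt \<bar>c\<bar>\<close>.
  If \<open>k \<ge> 5\<close>, the expectation of \<open>1 / sqrt \<bar>x\<^sub>0 \<bullet> x\<^sub>m\<^sub>-\<^sub>1\<bar>\<close> is bounded by going back two further
  steps: the first one produces a factor \<open>(1 - (x\<^sub>0 \<bullet> x\<^sub>m\<^sub>-\<^sub>2)\<^sup>2) powr (- 1/4)\<close>, and this singularity
  is mild enough to be integrable (or absent, when \<open>x\<^sub>m\<^sub>-\<^sub>2\<close> is orthogonal to \<open>x\<^sub>0\<close>).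

  Singular factors are written with the inverse on \<open>ennreal\<close>, where \<open>inverse 0 = top\<close>;
  real division would hide the singularities.
\<close>

lemma ennreal_inverse_antimono:
  fixes a b :: ennreal
  assumes "a \<le> b"
  shows "inverse b \<le> inverse a"
proof (cases "a = 0 \<or> b = top")
  case False
  then obtain x y where "a = ennreal x" "b = ennreal y" "0 < x" "0 < y"
    using assms by (cases a; cases b) (auto simp: top_unique)
  then show ?thesis
    using assms by (auto simp: inverse_ennreal intro!: ennreal_leI)
qed auto

section \<open>Orthogonal projections and Gram determinants\<close>

text \<open>Projection onto the orthogonal complement of \<open>a\<close>. As division by 0 yields
  0, \<open>reject 0 x = x\<close>, which keeps the formulas below valid for degenerate
  families.\<close>

definition reject :: "'a::real_inner \<Rightarrow> 'a \<Rightarrow> 'a" where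
  "reject a x = x - ((x \<bullet> a) / (a \<bullet> a)) *\<^sub>R a"

lemma reject_orthogonal: "reject a x \<bullet> a = 0"
  by (cases "a = 0") (simp_all add: reject_def inner_diff_left)

lemma reject_inner:
  assumes "w \<bullet> a = 0"
  shows "w \<bullet> reject a x = w \<bullet> x"
  using assms by (simp add: reject_def inner_diff_right)

lemma norm_reject_le: "norm (reject a x) \<le> norm x"
proof -
  let ?t = "(x \<bullet> a) / (a \<bullet> a)"
  have "x = reject a x + ?t *\<^sub>R a" by (simp add: reject_def)
  moreover have "orthogonal (reject a x) (?t *\<^sub>R a)"
    by (simp add: orthogonal_def reject_orthogonal)
  ultimately have "(norm x)\<^sup>2 = (norm (reject a x))\<^sup>2 + (norm (?t *\<^sub>R a))\<^sup>2"
    by (metis norm_add_Pythagorean)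
  then show ?thesis
    by (metis le_add_same_cancel1 norm_ge_zero power2_le_imp_le zero_le_power2)
qed

lemma borel_measurable_reject [measurable (raw)]:
  fixes f g :: "'b \<Rightarrow> 'a::euclidean_space"
  assumes [measurable]: "f \<in> borel_measurable M" "g \<in> borel_measurable M"
  shows "(\<lambda>x. reject (f x) (g x)) \<in> borel_measurable M"
  unfolding reject_def by measurable

lemma borel_measurable_sgn' [measurable (raw)]:
  fixes f :: "'b \<Rightarrow> 'a::euclidean_space"
  assumes [measurable]: "f \<in> borel_measurable M"
  shows "(\<lambda>x. sgn (f x)) \<in> borel_measurable M"
  unfolding sgn_div_norm by measurable

text \<open>Two candidates differ by a vector that lies in \<open>span S\<close> and is orthogonal
  to it, hence by 0.\<close>

lemma perp_proj_eqI:
  assumes "\<And>s. s \<in> S \<Longrightarrow> z \<bullet> s = 0" and "y - z \<in> span S"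
  shows "perp_proj S y = z"
  unfolding perp_proj_def
proof (rule the_equality)
  show "(\<forall>s\<in>S. z \<bullet> s = 0) \<and> y - z \<in> span S" using assms by blast
  fix z' assume z': "(\<forall>s\<in>S. z' \<bullet> s = 0) \<and> y - z' \<in> span S"
  have "(y - z') - (y - z) \<in> span S" using z' assms(2) by (blast intro: span_diff)
  then have "z - z' \<in> span S" by simp
  moreover have "orthogonal (z - z') s" if "s \<in> S" for s
    using that z' assms(1) by (simp add: orthogonal_def inner_diff_left)
  ultimately have "orthogonal (z - z') (z - z')"
    by (rule orthogonal_to_span)
  then show "z' = z" by (simp add: orthogonal_self)
qed

lemma perp_proj_empty: "perp_proj {} y = y"
  by (rule perp_proj_eqI) auto

lemma perp_proj_singleton: "perp_proj {a} y = reject a y"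
proof (rule perp_proj_eqI)
  show "y - reject a y \<in> span {a}" by (simp add: reject_def span_base span_scale)
qed (simp add: reject_orthogonal)

text \<open>Gram-Schmidt: \<open>a\<close> and \<open>reject a b\<close> are orthogonal and have the
  same span as \<open>a\<close> and \<open>b\<close>. If \<open>b\<close> is a multiple of
  \<open>a\<close>, the second rejection is by 0 and changes nothing.\<close>

lemma perp_proj_doubleton: "perp_proj {a, b} y = reject (reject a b) (reject a y)"
proof (rule perp_proj_eqI)
  let ?r = "reject (reject a b) (reject a y)"
  have a: "?r \<bullet> a = 0"
    using reject_orthogonal[of a b] reject_orthogonal[of a y]
    by (subst reject_def) (simp add: inner_diff_left)
  moreover have "?r \<bullet> b = ?r \<bullet> (reject a b + ((b \<bullet> a) / (a \<bullet> a)) *\<^sub>R a)"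
    by (rule arg_cong[where f = "(\<bullet>) ?r"]) (simp add: reject_def)
  then have "?r \<bullet> b = 0"
    by (simp add: a inner_add_right reject_orthogonal)
  ultimately show "?r \<bullet> s = 0" if "s \<in> {a, b}" for s using that by auto
  have ab: "a \<in> span {a, b}" "b \<in> span {a, b}" by (auto intro: span_base)
  have "reject a b \<in> span {a, b}"
    unfolding reject_def by (intro span_diff span_scale ab)
  moreover have "y - ?r = ((y \<bullet> a) / (a \<bullet> a)) *\<^sub>R a +
      ((reject a y \<bullet> reject a b) / (reject a b \<bullet> reject a b)) *\<^sub>R reject a b"
  proof -
    have *: "z - reject u r = (z - r) + ((r \<bullet> u) / (u \<bullet> u)) *\<^sub>R u" for z u r :: 'a
      by (simp add: reject_def)
    show ?thesis
      by (simp only: *[of y "reject a b" "reject a y"] *[of y a y] diff_self add_0_left)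
  qed
  ultimately show "y - ?r \<in> span {a, b}"
    using ab by (metis span_add span_scale)
qed

lemma gram_det_singleton: "gram_det {i} y = (norm (y i))\<^sup>2"
  by (simp add: gram_det_def power2_norm_eq_inner)

text \<open>For unit vectors this is the squared sine of the angle between them.\<close>

lemma gram_det_doubleton:
  assumes "i \<noteq> j"
  shows "gram_det {i, j} y = (norm (y i))\<^sup>2 * (norm (y j))\<^sup>2 - (y i \<bullet> y j)\<^sup>2"
proof -
  have "{\<sigma>. \<sigma> permutes {i, j}} = {id, Transposition.transpose i j}"
    by (auto simp: permutes_doubleton_iff)
  moreover have "id \<noteq> Transposition.transpose i j"
    using assms by (metis id_apply transpose_apply_first)
  ultimately show ?thesis
    using assms
    by (simp add: gram_det_def sign_swap_id dot_square_norm inner_commute[of "y j"] power2_eq_square)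
qed

section \<open>Householder reflections\<close>

definition householder :: "'a::real_inner \<Rightarrow> 'a \<Rightarrow> 'a" where
  "householder v x = x - (2 * (x \<bullet> v) / (v \<bullet> v)) *\<^sub>R v"

lemma orthogonal_transformation_householder: "orthogonal_transformation (householder v)"
  unfolding orthogonal_transformation_def
proof (intro conjI allI)
  show "linear (householder v)"
    by (rule linearI)
      (simp_all add: householder_def inner_add_left distrib_left add_divide_distrib
        scaleR_add_left scaleR_diff_right mult.left_commute)
  show "householder v x \<bullet> householder v y = x \<bullet> y" for x y
  proof (cases "v = 0")
    case False
    \<comment> \<open>The term quadratic in \<open>v\<close> equals the sum of the two mixed terms,
      so they cancel in the expanded inner product.\<close>
    have "2 * s / n * (2 * t / n * n) = 2 * s / n * t + 2 * t / n * s" if "n \<noteq> 0" for n s t :: real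
      using that by (simp add: field_simps)
    from this[of "v \<bullet> v" "y \<bullet> v" "x \<bullet> v"] False
    have "(2 * (y \<bullet> v) / (v \<bullet> v)) * ((2 * (x \<bullet> v) / (v \<bullet> v)) * (v \<bullet> v)) =
        2 * (y \<bullet> v) / (v \<bullet> v) * (x \<bullet> v) + 2 * (x \<bullet> v) / (v \<bullet> v) * (y \<bullet> v)"
      by simp
    then show ?thesis
      unfolding householder_def inner_diff_left inner_diff_right inner_scaleR_left inner_scaleR_right
        inner_commute[of v y]
      by (simp only: right_diff_distrib)
  qed (simp add: householder_def)
qed

text \<open>Equal norms make the coefficient of the reflection equal to 1, so exactly
  \<open>a - b\<close> is subtracted from \<open>a\<close>.\<close>

lemma householder_swap:
  assumes "norm a = norm b"
  shows "householder (a - b) a = b"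
proof (cases "a = b")
  case False
  have "2 * (a \<bullet> (a - b)) = (a - b) \<bullet> (a - b)"
    using assms by (simp add: inner_diff_left inner_diff_right inner_commute norm_eq)
  with False show ?thesis by (simp add: householder_def)
qed (simp add: householder_def)

lemma householder_fix:
  assumes "x \<bullet> v = 0"
  shows "householder v x = x"
  using assms by (simp add: householder_def)

text \<open>Two reflections suffice: \<open>R\<close> moves \<open>a\<close> to \<open>c\<close>,
  and the second moves \<open>R b\<close> to \<open>d\<close>. The latter fixes \<open>c\<close>
  because \<open>R b\<close> and \<open>d\<close> are both orthogonal to \<open>c\<close>.\<close>

lemma orthogonal_transformation_orthonormal_pair:
  fixes a b c d :: "'a::real_inner"
  assumes "norm a = 1" "norm b = 1" "a \<bullet> b = 0" "norm c = 1" "norm d = 1" "c \<bullet> d = 0"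
  obtains T where "orthogonal_transformation T" "T a = c" "T b = d"
proof
  define R where "R = householder (a - c)"
  have R: "orthogonal_transformation R"
    unfolding R_def by (rule orthogonal_transformation_householder)
  have Ra: "R a = c" unfolding R_def using assms by (intro householder_swap) auto
  have "norm (R b) = norm d" using R assms by (simp add: orthogonal_transformation_norm)
  then have Rb: "householder (R b - d) (R b) = d" by (rule householder_swap)
  have "c \<bullet> R b = 0" using R Ra assms by (metis orthogonal_transformation_def)
  then have c: "householder (R b - d) c = c"
    using assms by (intro householder_fix) (simp add: inner_diff_right)
  show "orthogonal_transformation (householder (R b - d) \<circ> R)"
    using orthogonal_transformation_householder R by (rule orthogonal_transformation_compose)
  show "(householder (R b - d) \<circ> R) a = c" by (simp add: Ra c)
  show "(householder (R b - d) \<circ> R) b = d" by (simp add: Rb)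
qed

lemma unit_orthogonal_exists:
  fixes S :: "'a::euclidean_space set"
  assumes "finite S" "card S < DIM('a)"
  obtains w where "norm w = 1" "\<And>s. s \<in> S \<Longrightarrow> w \<bullet> s = 0"
proof -
  have "dim S < DIM('a)" using assms by (meson dim_le_card' le_less_trans)
  then obtain x where x: "x \<noteq> 0" "\<And>y. y \<in> span S \<Longrightarrow> orthogonal x y"
    using orthogonal_to_subspace_exists by blast
  show thesis
  proof (rule that[of "sgn x"])
    show "norm (sgn x) = 1" using x by (simp add: norm_sgn)
    show "sgn x \<bullet> s = 0" if "s \<in> S" for s
      using x(2)[of s] that by (simp add: sgn_div_norm orthogonal_def span_base)
  qed
qed

section \<open>The Gaussian measure\<close>

lemma sets_std_gauss [measurable_cong]: "sets (std_gauss :: 'a::euclidean_space measure) = sets borel"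
  by (simp add: std_gauss_def)

lemma nn_integral_std_gauss:
  fixes f :: "'a::euclidean_space \<Rightarrow> ennreal"
  assumes [measurable]: "f \<in> borel_measurable borel"
  shows "(\<integral>\<^sup>+x. f x \<partial>std_gauss) =
    (\<integral>\<^sup>+x. ennreal ((2 * pi) powr (- real DIM('a) / 2) * exp (- (norm x)\<^sup>2 / 2)) * f x \<partial>lborel)"
  unfolding std_gauss_def by (subst nn_integral_density) auto

text \<open>Used with \<open>c = 2\<close> for the density and with \<open>c = 4\<close> once a
  factor \<open>norm h\<close> has been absorbed.\<close>

lemma exp_norm_square:
  fixes x :: "'a::euclidean_space"
  shows "exp (- (norm x)\<^sup>2 / c) = (\<Prod>b\<in>Basis. exp (- (x \<bullet> b)\<^sup>2 / c))"
proof -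
  have "(norm x)\<^sup>2 = (\<Sum>b\<in>Basis. (x \<bullet> b)\<^sup>2)"
    by (simp add: norm_eq_sqrt_inner euclidean_inner[of x x] power2_eq_square sum_nonneg)
  then show ?thesis
    by (simp add: sum_negf[symmetric] sum_divide_distrib exp_sum)
qed

text \<open>The density is a product of one-dimensional standard normal densities over the basis,
  each of total mass 1.\<close>

lemma prob_space_std_gauss: "prob_space (std_gauss :: 'a::euclidean_space measure)"
proof
  have "(2 * pi) powr (- real DIM('a) / 2) = (\<Prod>b\<in>(Basis :: 'a set). 1 / sqrt (2 * pi))"
    by (simp add: powr_minus powr_half_sqrt[symmetric] powr_powr powr_realpow[symmetric]
        inverse_eq_divide power_one_over del: powr_half_sqrt)
  then have dens: "(2 * pi) powr (- real DIM('a) / 2) * exp (- (norm x)\<^sup>2 / 2) =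
      (\<Prod>b\<in>Basis. std_normal_density (x \<bullet> b))" for x :: 'a
    unfolding exp_norm_square by (simp add: std_normal_density_def prod_dividef power_one_over)
  have one: "(\<integral>\<^sup>+x. ennreal (std_normal_density x) \<partial>lborel) = 1"
    by (subst nn_integral_eq_integral) auto
  have "emeasure (std_gauss :: 'a measure) (space std_gauss) = (\<integral>\<^sup>+x. 1 \<partial>(std_gauss :: 'a measure))"
    by simp
  also have "\<dots> = (\<integral>\<^sup>+x. (\<Prod>b\<in>(Basis::'a set). ennreal (std_normal_density (x \<bullet> b))) \<partial>lborel)"
    by (subst nn_integral_std_gauss) (simp_all only: dens prod_ennreal normal_density_nonneg mult_1_right borel_measurable_const)
  also have "\<dots> = 1"
    by (subst nn_integral_lborel_prod) (auto simp: one)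
  finally show "emeasure (std_gauss :: 'a measure) (space std_gauss) = 1" .
qed

lemma AE_std_gauss_inner_neq_0:
  fixes w :: "'a::euclidean_space"
  assumes "w \<noteq> 0"
  shows "AE h in std_gauss. w \<bullet> h \<noteq> 0"
proof -
  have "{h. w \<bullet> h = 0} \<in> null_sets lborel"
    using negligible_hyperplane[of w 0] assms
    by (auto simp: negligible_iff_null_sets null_sets_completion_iff)
  then have "AE h in lborel. w \<bullet> h \<noteq> 0" by (auto dest: AE_not_in)
  then show ?thesis unfolding std_gauss_def by (subst AE_density) auto
qed

section \<open>Invariance of Lebesgue and Gaussian measure\<close>

lemma nn_integral_lborel_minus:
  fixes f :: "'a::euclidean_space \<Rightarrow> ennreal"
  assumes [measurable]: "f \<in> borel_measurable borel"
  shows "(\<integral>\<^sup>+y. f (a - y) \<partial>lborel) = (\<integral>\<^sup>+y. f y \<partial>lborel)"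
proof -
  have "lborel = distr lborel borel (\<lambda>y. a - y)"
    using lborel_affine[of "-1" a] by (simp add: density_1)
  then have "(\<integral>\<^sup>+y. f y \<partial>lborel) = (\<integral>\<^sup>+y. f y \<partial>distr lborel borel (\<lambda>y. a - y))"
    by simp
  also have "\<dots> = (\<integral>\<^sup>+y. f (a - y) \<partial>lborel)"
    by (rule nn_integral_distr) auto
  finally show ?thesis by simp
qed

text \<open>A translation is the composition of two point reflections.\<close>

lemma nn_integral_lborel_plus:
  fixes f :: "'a::euclidean_space \<Rightarrow> ennreal"
  assumes [measurable]: "f \<in> borel_measurable borel"
  shows "(\<integral>\<^sup>+y. f (y + a) \<partial>lborel) = (\<integral>\<^sup>+y. f y \<partial>lborel)"
  using nn_integral_lborel_minus[of "\<lambda>y. f (a - y)" 0] nn_integral_lborel_minus[of f a]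
  by (simp add: add.commute)

lemma borel_measurable_orthogonal_transformation:
  fixes T :: "'a::euclidean_space \<Rightarrow> 'a"
  assumes "orthogonal_transformation T"
  shows "T \<in> borel_measurable borel"
  using assms
  by (intro borel_measurable_continuous_onI linear_continuous_on linear_linear[THEN iffD2]
      orthogonal_transformation_linear)

text \<open>The uniqueness argument for Haar measure: Fubini applied to \<open>f (T x) * g (T x + y)\<close>,
  where \<open>g\<close> is the indicator of a ball and hence \<open>T\<close>-invariant.\<close>

lemma nn_integral_lborel_orthogonal_transformation:
  fixes T :: "'a::euclidean_space \<Rightarrow> 'a"
  assumes T: "orthogonal_transformation T" and [measurable]: "f \<in> borel_measurable borel"
  shows "(\<integral>\<^sup>+x. f (T x) \<partial>lborel) = (\<integral>\<^sup>+x. f x \<partial>lborel)"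
proof -
  note borel_measurable_orthogonal_transformation[OF T, measurable]
  define g :: "'a \<Rightarrow> ennreal" where "g = indicator (ball 0 1)"
  have [measurable]: "g \<in> borel_measurable borel" unfolding g_def by (intro borel_measurable_indicator) simp
  have gT: "g (T x) = g x" for x
    using T by (simp add: g_def indicator_def orthogonal_transformation_norm)
  have g: "(\<integral>\<^sup>+x. g x \<partial>lborel) = emeasure lborel (ball (0::'a) 1)"
    unfolding g_def by (subst nn_integral_indicator) auto
  \<comment> \<open>The volume of the ball is finite and, as shown next, nonzero; so it can be
    cancelled at the end.\<close>
  have fin: "(\<integral>\<^sup>+x. g x \<partial>lborel) < top"
    unfolding g using emeasure_bounded_finite[of "ball (0::'a) 1"] by simp
  have "ball (0::'a) 1 \<notin> null_sets lborel"
    using open_not_negligible[of "ball (0::'a) 1"]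
    by (auto simp: negligible_iff_null_sets null_sets_completionI)
  then have pos: "(\<integral>\<^sup>+x. g x \<partial>lborel) \<noteq> 0" 
    unfolding g by (auto simp: null_sets_def)
  have shift: "T (x - inv T y) = T x - y" for x y
    using T by (metis bij_inv_eq_iff linear_diff orthogonal_transformation_bij
        orthogonal_transformation_linear)
  have "(\<integral>\<^sup>+x. f (T x) \<partial>lborel) * (\<integral>\<^sup>+y. g y \<partial>lborel) = (\<integral>\<^sup>+x. (\<integral>\<^sup>+y. f (T x) * g y \<partial>lborel) \<partial>lborel)"
    by (simp add: nn_integral_cmult nn_integral_multc)
  also have "\<dots> = (\<integral>\<^sup>+x. (\<integral>\<^sup>+y. f (T x) * g (y + T x) \<partial>lborel) \<partial>lborel)"
  proof (rule nn_integral_cong)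
    fix x
    show "(\<integral>\<^sup>+y. f (T x) * g y \<partial>lborel) = (\<integral>\<^sup>+y. f (T x) * g (y + T x) \<partial>lborel)"
      using nn_integral_lborel_plus[of "\<lambda>y. f (T x) * g y" "T x"] by simp
  qed
  also have "\<dots> = (\<integral>\<^sup>+y. (\<integral>\<^sup>+x. f (T x) * g (y + T x) \<partial>lborel) \<partial>lborel)"
    by (rule lborel_pair.Fubini') measurable
  \<comment> \<open>Translating \<open>x\<close> by \<open>- inv T y\<close> leaves
    \<open>g (T x)\<close>, from which \<open>T\<close> disappears by invariance. The remaining
    argument \<open>T x - y\<close> of \<open>f\<close> is handled by reflecting
    \<open>y\<close>.\<close>
  also have "\<dots> = (\<integral>\<^sup>+y. (\<integral>\<^sup>+x. f (T x - y) * g (T x) \<partial>lborel) \<partial>lborel)"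
  proof (rule nn_integral_cong)
    fix y
    show "(\<integral>\<^sup>+x. f (T x) * g (y + T x) \<partial>lborel) = (\<integral>\<^sup>+x. f (T x - y) * g (T x) \<partial>lborel)"
      using nn_integral_lborel_plus[of "\<lambda>x. f (T x) * g (y + T x)" "- inv T y"]
      by (simp add: shift)
  qed
  also have "\<dots> = (\<integral>\<^sup>+x. (\<integral>\<^sup>+y. f (T x - y) * g (T x) \<partial>lborel) \<partial>lborel)"
    by (rule lborel_pair.Fubini') measurable
  also have "\<dots> = (\<integral>\<^sup>+x. f x \<partial>lborel) * (\<integral>\<^sup>+y. g y \<partial>lborel)"
    by (simp add: nn_integral_multc nn_integral_cmult nn_integral_lborel_minus gT)
  finally show ?thesis
    using fin pos by (metis ennreal_mult_divide_eq top.not_eq_extremum)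
qed

text \<open>The Gaussian density depends on the norm only.\<close>

lemma nn_integral_std_gauss_orthogonal_transformation:
  fixes T :: "'a::euclidean_space \<Rightarrow> 'a"
  assumes T: "orthogonal_transformation T" and [measurable]: "f \<in> borel_measurable borel"
  shows "(\<integral>\<^sup>+x. f (T x) \<partial>std_gauss) = (\<integral>\<^sup>+x. f x \<partial>std_gauss)"
proof -
  note borel_measurable_orthogonal_transformation[OF T, measurable]
  show ?thesis
    using nn_integral_lborel_orthogonal_transformation[OF T, of "\<lambda>x.
        ennreal ((2 * pi) powr (- real DIM('a) / 2) * exp (- (norm x)\<^sup>2 / 2)) * f x"]
    by (simp add: nn_integral_std_gauss orthogonal_transformation_norm[OF T])
qed

section \<open>One-dimensional Gaussian integrals with a power singularity\<close>

text \<open>From \<open>(\<bar>x\<bar> / 2 - 1)\<^sup>2 \<ge> 0\<close> the exponent is at most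
  \<open>1 - \<bar>x\<bar>\<close>, so \<open>exp 1\<close> times the Gamma integrand dominates on
  each half-line.\<close>

lemma nn_integral_abs_powr_gauss_finite:
  assumes "0 < s"
  shows "(\<integral>\<^sup>+x. ennreal (\<bar>x\<bar> powr (s - 1) * exp (- x\<^sup>2 / 4)) \<partial>lborel) < top"
proof -
  define F :: "real \<Rightarrow> ennreal" where "F t = ennreal (indicator {0..} t * t powr (s - 1) / exp t)" for t
  have [measurable]: "F \<in> borel_measurable borel" unfolding F_def by measurable
  have F: "(\<integral>\<^sup>+t. F t \<partial>lborel) = ennreal (Gamma s)"
    unfolding F_def using Gamma_conv_nn_integral_real[OF assms] by simp
  have bound: "ennreal (\<bar>x\<bar> powr (s - 1) * exp (- x\<^sup>2 / 4)) \<le> ennreal (exp 1) * (F x + F (- x))" for x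
  proof -
    have "0 \<le> (\<bar>x\<bar> / 2 - 1)\<^sup>2" by simp
    then have "- x\<^sup>2 / 4 \<le> 1 - \<bar>x\<bar>" by (simp add: power2_diff power_divide)
    then have "exp (- x\<^sup>2 / 4) \<le> exp 1 / exp \<bar>x\<bar>" by (simp add: exp_diff[symmetric])
    then have "\<bar>x\<bar> powr (s - 1) * exp (- x\<^sup>2 / 4) \<le> \<bar>x\<bar> powr (s - 1) * (exp 1 / exp \<bar>x\<bar>)"
      by (intro mult_left_mono) auto
    then have "ennreal (\<bar>x\<bar> powr (s - 1) * exp (- x\<^sup>2 / 4)) \<le> ennreal (exp 1 * (\<bar>x\<bar> powr (s - 1) / exp \<bar>x\<bar>))"
      by (intro ennreal_leI) (simp add: mult_ac)
    also have "\<dots> = ennreal (exp 1) * F \<bar>x\<bar>"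
      by (subst ennreal_mult) (auto simp: F_def)
    also have "\<dots> \<le> ennreal (exp 1) * (F x + F (- x))"
      by (intro mult_left_mono) (auto simp: abs_if)
    finally show ?thesis .
  qed
  have "(\<integral>\<^sup>+x. ennreal (\<bar>x\<bar> powr (s - 1) * exp (- x\<^sup>2 / 4)) \<partial>lborel)
      \<le> (\<integral>\<^sup>+x. ennreal (exp 1) * (F x + F (- x)) \<partial>lborel)"
    by (intro nn_integral_mono bound)
  also have "\<dots> = ennreal (exp 1) * (ennreal (Gamma s) + ennreal (Gamma s))"
    using nn_integral_lborel_minus[of F 0] by (simp add: nn_integral_cmult nn_integral_add F)
  also have "\<dots> < top" by (simp add: ennreal_mult_less_top)
  finally show ?thesis .
qed

lemma AE_lborel_neq: "AE x in lborel. x \<noteq> (c :: real)"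
  using AE_lborel_singleton[of c] by auto

lemma nn_integral_gauss_finite: "(\<integral>\<^sup>+x. ennreal (exp (- x\<^sup>2 / 4)) \<partial>lborel) < top"
proof -
  have "(\<integral>\<^sup>+x. ennreal (exp (- x\<^sup>2 / 4)) \<partial>lborel) =
      (\<integral>\<^sup>+x. ennreal (\<bar>x\<bar> powr (1 - 1) * exp (- x\<^sup>2 / 4)) \<partial>lborel)"
    \<comment> \<open>The integrands differ at 0, where \<open>0 powr 0 = 0\<close>.\<close>
    using AE_lborel_neq[of 0] by (intro nn_integral_cong_AE) (auto elim!: eventually_mono)
  then show ?thesis using nn_integral_abs_powr_gauss_finite[of 1] by simp
qed

text \<open>The case \<open>s = 1/2\<close>. The integrand is \<open>top\<close> at 0, but only on a
  null set.\<close>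

lemma nn_integral_inverse_sqrt_gauss_finite:
  "(\<integral>\<^sup>+x. inverse (ennreal (sqrt \<bar>x\<bar>)) * ennreal (exp (- x\<^sup>2 / 4)) \<partial>lborel) < top"
proof -
  have *: "inverse (ennreal (sqrt \<bar>x\<bar>)) * ennreal (exp (- x\<^sup>2 / 4)) =
      ennreal (\<bar>x\<bar> powr (1/2 - 1) * exp (- x\<^sup>2 / 4))" if "x \<noteq> 0" for x :: real
  proof -
    have "inverse (sqrt \<bar>x\<bar>) = \<bar>x\<bar> powr (1/2 - 1)"
      using that by (simp add: powr_minus powr_half_sqrt)
    then show ?thesis
      using that by (simp add: inverse_ennreal ennreal_mult)
  qed
  have "(\<integral>\<^sup>+x. inverse (ennreal (sqrt \<bar>x\<bar>)) * ennreal (exp (- x\<^sup>2 / 4)) \<partial>lborel) =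
      (\<integral>\<^sup>+x. ennreal (\<bar>x\<bar> powr (1/2 - 1) * exp (- x\<^sup>2 / 4)) \<partial>lborel)"
    using AE_lborel_neq[of 0] * by (intro nn_integral_cong_AE) (auto elim!: eventually_mono)
  then show ?thesis using nn_integral_abs_powr_gauss_finite[of "1/2"] by simp
qed

text \<open>Half of the Gaussian exponent absorbs a linear factor.\<close>

lemma mult_exp_square_le:
  fixes t :: real
  shows "t * exp (- t\<^sup>2 / 2) \<le> exp (- t\<^sup>2 / 4)"
proof -
  have "0 \<le> (t / 2 - 1)\<^sup>2" by simp
  then have "t \<le> 1 + t\<^sup>2 / 4" by (simp add: power2_diff power_divide)
  also have "\<dots> \<le> exp (t\<^sup>2 / 4)" by (rule exp_ge_add_one_self)
  finally have "t * exp (- t\<^sup>2 / 2) \<le> exp (t\<^sup>2 / 4) * exp (- t\<^sup>2 / 2)"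
    by (intro mult_right_mono) auto
  also have "\<dots> = exp (- t\<^sup>2 / 4)"
    by (simp add: exp_add[symmetric])
  finally show ?thesis .
qed

section \<open>The majorant kernel and its uniform bound\<close>

text \<open>Homogeneous of degree 0 in \<open>h\<close>, as suits functions of a direction. Each of
  the two singularities has exponent -1/2, which is integrable on the line.\<close>

definition gauss_kernel :: "'a::euclidean_space \<Rightarrow> 'a \<Rightarrow> 'a \<Rightarrow> ennreal" where
  "gauss_kernel v w h = ennreal (norm h) * inverse (ennreal (sqrt \<bar>v \<bullet> h\<bar> * sqrt \<bar>w \<bullet> h\<bar>))"

lemma borel_measurable_gauss_kernel [measurable]: "gauss_kernel v w \<in> borel_measurable borel"
  unfolding gauss_kernel_def by measurable

text \<open>Once \<open>norm h\<close> is absorbed, the integrand is a product of functions of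
  single coordinates. With \<open>e \<noteq> f\<close> the singularities sit in different
  coordinates; in the same one they would combine to the non-integrable
  \<open>1 / \<bar>x\<bar>\<close>.\<close>

lemma nn_integral_gauss_kernel_Basis_finite:
  fixes e f :: "'a::euclidean_space"
  assumes "e \<in> Basis" "f \<in> Basis" "e \<noteq> f"
  shows "(\<integral>\<^sup>+h. gauss_kernel e f h \<partial>std_gauss) < top"
proof -
  let ?C = "(2 * pi) powr (- real DIM('a) / 2)"
  define u :: "'a \<Rightarrow> real \<Rightarrow> ennreal" where
    "u b x = (if b \<in> {e, f} then inverse (ennreal (sqrt \<bar>x\<bar>)) else 1) * ennreal (exp (- x\<^sup>2 / 4))" for b x
  have [measurable]: "u b \<in> borel_measurable borel" for b
    unfolding u_def by measurable
  have fin: "(\<integral>\<^sup>+x. u b x \<partial>lborel) < top" for b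
    using nn_integral_inverse_sqrt_gauss_finite nn_integral_gauss_finite
    by (cases "b \<in> {e, f}") (auto simp: u_def)
  have bound: "ennreal (?C * exp (- (norm h)\<^sup>2 / 2)) * gauss_kernel e f h
      \<le> ennreal ?C * (\<Prod>b\<in>Basis. u b (h \<bullet> b))" for h :: 'a
  proof -
    let ?I = "inverse (ennreal (sqrt \<bar>e \<bullet> h\<bar> * sqrt \<bar>f \<bullet> h\<bar>))"
    have "(\<Prod>b\<in>Basis. if b \<in> {e, f} then inverse (ennreal (sqrt \<bar>h \<bullet> b\<bar>)) else 1)
        = (\<Prod>b\<in>{e, f}. inverse (ennreal (sqrt \<bar>h \<bullet> b\<bar>)))"
      using assms by (intro prod.mono_neutral_cong_right) auto
    also have "\<dots> = ?I"
      using assms by (simp add: ennreal_mult ennreal_inverse_mult inner_commute)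
    finally have u: "(\<Prod>b\<in>Basis. u b (h \<bullet> b)) = ?I * ennreal (exp (- (norm h)\<^sup>2 / 4))"
      unfolding u_def exp_norm_square prod.distrib by (simp add: prod_ennreal)
    have "ennreal (?C * exp (- (norm h)\<^sup>2 / 2)) * gauss_kernel e f h =
        ennreal ?C * (?I * ennreal (norm h * exp (- (norm h)\<^sup>2 / 2)))"
      by (simp add: gauss_kernel_def ennreal_mult mult_ac)
    also have "\<dots> \<le> ennreal ?C * (?I * ennreal (exp (- (norm h)\<^sup>2 / 4)))"
      by (intro mult_left_mono ennreal_leI mult_exp_square_le) auto
    finally show ?thesis by (simp add: u)
  qed
  have "(\<integral>\<^sup>+h. gauss_kernel e f h \<partial>std_gauss) \<le> (\<integral>\<^sup>+h. ennreal ?C * (\<Prod>b\<in>Basis. u b (h \<bullet> b)) \<partial>lborel)"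
    by (subst nn_integral_std_gauss) (measurable, intro nn_integral_mono bound)
  also have "\<dots> = ennreal ?C * (\<Prod>b\<in>Basis. \<integral>\<^sup>+x. u b x \<partial>lborel)"
    by (subst nn_integral_cmult, measurable) (subst nn_integral_lborel_prod, auto)
  also have "\<dots> < top"
    using fin by (simp add: ennreal_mult_eq_top_iff ennreal_prod_eq_top less_top[symmetric])
  finally show ?thesis .
qed

text \<open>Rotation invariance carries every orthonormal pair to one fixed pair of basis vectors,
  so a single constant serves all.\<close>

lemma nn_integral_gauss_kernel_bound:
  assumes "2 \<le> DIM('a::euclidean_space)"
  obtains K :: real where "\<And>v w :: 'a. norm v = 1 \<Longrightarrow> norm w = 1 \<Longrightarrow> v \<bullet> w = 0 \<Longrightarrow>
      (\<integral>\<^sup>+h. gauss_kernel v w h \<partial>std_gauss) \<le> ennreal K"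
proof -
  obtain e f :: 'a where ef: "e \<in> Basis" "f \<in> Basis" "e \<noteq> f"
    using assms by (metis card_le_Suc0_iff_eq finite_Basis not_less_eq_eq numeral_2_eq_2)
  obtain K0 where K0: "(\<integral>\<^sup>+h. gauss_kernel e f h \<partial>std_gauss) = ennreal K0"
    using nn_integral_gauss_kernel_Basis_finite[OF ef] by (metis less_top_ennreal)
  show thesis
  proof (rule that[of K0])
    fix v w :: 'a
    assume vw: "norm v = 1" "norm w = 1" "v \<bullet> w = 0"
    obtain T where T: "orthogonal_transformation T" "T v = e" "T w = f"
      using orthogonal_transformation_orthonormal_pair[OF vw, of e f] ef
      by (auto simp: inner_Basis)
    have "gauss_kernel e f (T h) = gauss_kernel v w h" for h
    proof -
      have "e \<bullet> T h = v \<bullet> h" "f \<bullet> T h = w \<bullet> h"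
        using T by (auto simp: orthogonal_transformation_def)
      then show ?thesis using T by (simp add: gauss_kernel_def orthogonal_transformation_norm)
    qed
    then show "(\<integral>\<^sup>+h. gauss_kernel v w h \<partial>std_gauss) \<le> ennreal K0"
      using nn_integral_std_gauss_orthogonal_transformation[OF T(1), of "gauss_kernel e f"] K0 by simp
  qed
qed

section \<open>One step of the sequential ortho-homomorphism\<close>

text \<open>\<open>w\<close> is the direction of \<open>reject z y\<close>. If that vector is 0, any
  unit vector orthogonal to \<open>z\<close> will do, with \<open>s = 0\<close>.\<close>

lemma orthonormal_frame:
  fixes y z :: "'a::euclidean_space"
  assumes "2 \<le> DIM('a)" "norm y = 1" "norm z = 1"
  obtains w s where "norm w = 1" "w \<bullet> z = 0" "y = (y \<bullet> z) *\<^sub>R z + s *\<^sub>R w" "s\<^sup>2 = 1 - (y \<bullet> z)\<^sup>2"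
proof -
  let ?r = "reject z y"
  have y: "y = (y \<bullet> z) *\<^sub>R z + ?r"
    using assms by (simp add: reject_def norm_eq_1)
  have "orthogonal ((y \<bullet> z) *\<^sub>R z) ?r"
    using reject_orthogonal[of z y] by (simp add: orthogonal_def inner_commute)
  then have "(norm y)\<^sup>2 = (norm ((y \<bullet> z) *\<^sub>R z))\<^sup>2 + (norm ?r)\<^sup>2"
    using norm_add_Pythagorean y by metis
  then have s: "(norm ?r)\<^sup>2 = 1 - (y \<bullet> z)\<^sup>2"
    using assms by simp
  show thesis
  proof (cases "?r = 0")
    case True
    obtain w where "norm w = 1" "\<And>u. u \<in> {z} \<Longrightarrow> w \<bullet> u = 0"
      using unit_orthogonal_exists[of "{z}"] assms by auto
    then show thesis using that[of w 0] y s True by auto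
  next
    case False
    then show thesis
      using that[of "sgn ?r" "norm ?r"] y s reject_orthogonal[of z y]
      by (simp add: norm_sgn sgn_div_norm)
  qed
qed

text \<open>For \<open>x = sgn r\<close> with \<open>r = reject z h\<close>, the inner product \<open>y \<bullet> x\<close> depends on
  \<open>h\<close> only through \<open>w \<bullet> h\<close> and \<open>norm r\<close>; further directions orthogonal to
  \<open>z\<close> and \<open>w\<close> bound \<open>1 - (y \<bullet> x)\<^sup>2\<close> from below.\<close>

lemma reject_inner_frame:
  fixes h :: "'a::euclidean_space"
  assumes "y = c *\<^sub>R z + s *\<^sub>R w" "w \<bullet> z = 0"
  shows "y \<bullet> sgn (reject z h) = s * (w \<bullet> h) / norm (reject z h)"
proof -
  have "y \<bullet> reject z h = s * (w \<bullet> h)"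
    using assms reject_orthogonal[of z h]
    by (simp add: inner_add_left reject_inner inner_commute[of z])
  then show ?thesis by (simp add: sgn_div_norm divide_inverse mult.commute)
qed

text \<open>For the projection \<open>p\<close> of \<open>r\<close> onto the span of
  \<open>W\<close>, \<open>p \<bullet> r = p \<bullet> p\<close>; the claim is that
  \<open>r - p\<close> has nonnegative squared norm.\<close>

lemma Bessel_inequality:
  fixes r :: "'a::euclidean_space"
  assumes "finite W" "pairwise orthogonal W" "\<And>w. w \<in> W \<Longrightarrow> norm w = 1"
  shows "(\<Sum>w\<in>W. (w \<bullet> r)\<^sup>2) \<le> (norm r)\<^sup>2"
proof -
  define p where "p = (\<Sum>w\<in>W. (w \<bullet> r) *\<^sub>R w)"
  have pw: "p \<bullet> w = w \<bullet> r" if "w \<in> W" for w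
  proof -
    have "p \<bullet> w = (\<Sum>v\<in>W. if v = w then w \<bullet> r else 0)"
      unfolding p_def inner_sum_left
    proof (rule sum.cong)
      fix v assume "v \<in> W"
      then show "((v \<bullet> r) *\<^sub>R v) \<bullet> w = (if v = w then w \<bullet> r else 0)"
        using assms(2,3) that by (auto simp: pairwise_def orthogonal_def norm_eq_1)
    qed simp
    then show ?thesis using that assms(1) by simp
  qed
  have pr: "p \<bullet> r = (\<Sum>w\<in>W. (w \<bullet> r)\<^sup>2)"
    by (simp add: p_def inner_sum_left power2_eq_square)
  have pp: "p \<bullet> p = (\<Sum>w\<in>W. (w \<bullet> r)\<^sup>2)"
    by (subst (2) p_def) (simp add: inner_sum_right pw power2_eq_square)
  have "0 \<le> (r - p) \<bullet> (r - p)" by simp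
  then show ?thesis
    using pr pp by (simp add: inner_diff_left inner_diff_right inner_commute power2_norm_eq_inner)
qed

text \<open>The point \<open>h = 0\<close> is excluded because the kernel is
  \<open>0 * top = 0\<close> there; at other zeros of the inner products it is
  \<open>top\<close>.\<close>

lemma inverse_le_gauss_kernel:
  assumes "a * (sqrt \<bar>v \<bullet> h\<bar> * sqrt \<bar>w \<bullet> h\<bar>) / norm h \<le> t" "0 \<le> a" "h \<noteq> 0"
  shows "inverse (ennreal t) \<le> inverse (ennreal a) * gauss_kernel v w h"
proof -
  let ?A = "sqrt \<bar>v \<bullet> h\<bar> * sqrt \<bar>w \<bullet> h\<bar>"
  have "inverse (ennreal t) \<le> inverse (ennreal (a * ?A / norm h))"
    using assms by (intro ennreal_inverse_antimono ennreal_leI)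
  also have "ennreal (a * ?A / norm h) = ennreal a * (ennreal (inverse (norm h)) * ennreal ?A)"
    using assms by (simp add: divide_inverse ennreal_mult[symmetric] mult_ac del: ennreal_mult'')
  also have "inverse \<dots> = inverse (ennreal a) * (inverse (ennreal (inverse (norm h))) * inverse (ennreal ?A))"
    by (simp add: ennreal_inverse_mult ennreal_mult_less_top)
  also have "inverse (ennreal (inverse (norm h))) = ennreal (norm h)"
    using assms by (subst inverse_ennreal) auto
  finally show ?thesis by (simp add: gauss_kernel_def)
qed

text \<open>One constant shared by all one-step estimates. The parameter \<open>type\<close> lets an
  interpretation name the space, which \<open>K\<close> does not mention.\<close>

locale gauss_kernel_bound =
  fixes K :: real and type :: "'a::euclidean_space itself"
  assumes K_bound: "\<And>v w :: 'a. norm v = 1 \<Longrightarrow> norm w = 1 \<Longrightarrow> v \<bullet> w = 0 \<Longrightarrow>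
      (\<integral>\<^sup>+h. gauss_kernel v w h \<partial>std_gauss) \<le> ennreal K"
begin

text \<open>Common frame of the four estimates below: it remains to bound \<open>F\<close> from
  below off the null hyperplane orthogonal to \<open>v\<close>. The coefficient \<open>a\<close>
  carries the dependence on the earlier positions.\<close>

lemma nn_integral_inverse_bound:
  fixes v w :: 'a
  assumes "norm v = 1" "norm w = 1" "v \<bullet> w = 0" "0 \<le> a"
    and le: "\<And>h. v \<bullet> h \<noteq> 0 \<Longrightarrow> a * (sqrt \<bar>v \<bullet> h\<bar> * sqrt \<bar>w \<bullet> h\<bar>) / norm h \<le> F h"
  shows "(\<integral>\<^sup>+h. inverse (ennreal (F h)) \<partial>std_gauss) \<le> ennreal K * inverse (ennreal a)"
proof -
  have "v \<noteq> 0" using assms by auto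
  then have "AE h in std_gauss. v \<bullet> h \<noteq> 0" by (rule AE_std_gauss_inner_neq_0)
  then have "(\<integral>\<^sup>+h. inverse (ennreal (F h)) \<partial>std_gauss)
      \<le> (\<integral>\<^sup>+h. inverse (ennreal a) * gauss_kernel v w h \<partial>std_gauss)"
    using assms by (intro nn_integral_mono_AE) (auto elim!: eventually_mono intro!: inverse_le_gauss_kernel)
  also have "\<dots> \<le> inverse (ennreal a) * ennreal K"
    using assms by (subst nn_integral_cmult) (auto intro!: mult_left_mono K_bound)
  finally show ?thesis by (simp add: mult.commute)
qed

end

lemma unit_orthogonal_two:
  fixes a b :: "'a::euclidean_space"
  assumes "3 \<le> DIM('a)"
  obtains v where "norm v = 1" "v \<bullet> a = 0" "v \<bullet> b = 0"
proof -
  have "card {a, b} < DIM('a)"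
    using assms by (auto simp: card_insert_if)
  then obtain v where v: "norm v = 1" "\<And>u. u \<in> {a, b} \<Longrightarrow> v \<bullet> u = 0"
    using unit_orthogonal_exists[of "{a, b}"] by blast
  show thesis by (rule that[OF v(1)]) (simp_all add: v(2))
qed

lemma unit_orthogonal_pair:
  fixes a b :: "'a::euclidean_space"
  assumes "4 \<le> DIM('a)"
  obtains v w where "norm v = 1" "norm w = 1" "v \<bullet> w = 0"
    "v \<bullet> a = 0" "v \<bullet> b = 0" "w \<bullet> a = 0" "w \<bullet> b = 0"
proof -
  obtain v where v: "norm v = 1" "v \<bullet> a = 0" "v \<bullet> b = 0"
    using unit_orthogonal_two[of a b] assms by auto
  have "card {a, b, v} < DIM('a)"
    using assms by (auto simp: card_insert_if)
  then obtain w where w: "norm w = 1" "\<And>u. u \<in> {a, b, v} \<Longrightarrow> w \<bullet> u = 0"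
    using unit_orthogonal_exists[of "{a, b, v}"] by blast
  show thesis
    by (rule that[OF v(1) w(1) _ v(2,3)]) (simp_all add: w(2) inner_commute[of v])
qed

lemma norm_reject_ge_frame:
  fixes h :: "'a::euclidean_space"
  assumes "finite W" "pairwise orthogonal W" "\<And>w. w \<in> W \<Longrightarrow> norm w = 1 \<and> w \<bullet> z = 0"
  shows "(\<Sum>w\<in>W. (w \<bullet> h)\<^sup>2) \<le> (norm (reject z h))\<^sup>2"
proof -
  have "(\<Sum>w\<in>W. (w \<bullet> h)\<^sup>2) = (\<Sum>w\<in>W. (w \<bullet> reject z h)\<^sup>2)"
    using assms(3) by (intro sum.cong) (auto simp: reject_inner)
  then show ?thesis using Bessel_inequality[of W "reject z h"] assms by simp
qed

section \<open>Estimates for a single step\<close>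

context gauss_kernel_bound begin

text \<open>With \<open>c = y \<bullet> z\<close>, the squared sine times the squared norm of
  \<open>reject z h\<close> is at least
  \<open>(v \<bullet> h)\<^sup>2 + (c * (w \<bullet> h))\<^sup>2\<close>, and the
  arithmetic-geometric mean inequality turns this sum into the product in the kernel.\<close>

lemma step_inverse_sine_bound:
  fixes y z :: 'a
  assumes "3 \<le> DIM('a)" "norm y = 1" "norm z = 1"
  shows "(\<integral>\<^sup>+h. inverse (ennreal (sqrt (1 - (y \<bullet> sgn (reject z h))\<^sup>2))) \<partial>std_gauss)
    \<le> ennreal K * inverse (ennreal (sqrt \<bar>y \<bullet> z\<bar>))"
proof -
  obtain w s where w: "norm w = 1" "w \<bullet> z = 0" "y = (y \<bullet> z) *\<^sub>R z + s *\<^sub>R w" "s\<^sup>2 = 1 - (y \<bullet> z)\<^sup>2"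
    using orthonormal_frame[of y z] assms by auto
  obtain v where v: "norm v = 1" "v \<bullet> w = 0" "v \<bullet> z = 0"
    using unit_orthogonal_two[OF assms(1)] by blast
  show ?thesis
  proof (rule nn_integral_inverse_bound[OF v(1) w(1) v(2)])
    fix h assume vh: "v \<bullet> h \<noteq> 0"
    let ?r = "norm (reject z h)" and ?c = "y \<bullet> z"
    have "v \<bullet> reject z h \<noteq> 0" using vh v by (simp add: reject_inner)
    then have r: "0 < ?r" by auto
    have "v \<noteq> w" using v by auto
    moreover have "pairwise orthogonal {v, w}"
      using v by (auto simp: pairwise_def orthogonal_def inner_commute)
    ultimately have "(v \<bullet> h)\<^sup>2 + (w \<bullet> h)\<^sup>2 \<le> ?r\<^sup>2"
      using norm_reject_ge_frame[of "{v, w}" z h] v w(1,2) by auto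
    moreover have "(s * (w \<bullet> h))\<^sup>2 = (w \<bullet> h)\<^sup>2 - (?c * (w \<bullet> h))\<^sup>2"
      by (simp add: power_mult_distrib w(4) left_diff_distrib)
    moreover have "0 \<le> (\<bar>v \<bullet> h\<bar> - \<bar>?c * (w \<bullet> h)\<bar>)\<^sup>2" by simp
    then have "2 * (\<bar>v \<bullet> h\<bar> * \<bar>?c * (w \<bullet> h)\<bar>) \<le> (v \<bullet> h)\<^sup>2 + (?c * (w \<bullet> h))\<^sup>2"
      by (simp add: power2_diff)
    moreover have "0 \<le> \<bar>v \<bullet> h\<bar> * \<bar>?c * (w \<bullet> h)\<bar>" by simp
    ultimately have "\<bar>v \<bullet> h\<bar> * \<bar>?c * (w \<bullet> h)\<bar> \<le> ?r\<^sup>2 - (s * (w \<bullet> h))\<^sup>2" by linarith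
    then have le: "sqrt \<bar>?c\<bar> * (sqrt \<bar>v \<bullet> h\<bar> * sqrt \<bar>w \<bullet> h\<bar>) \<le> sqrt (?r\<^sup>2 - (s * (w \<bullet> h))\<^sup>2)"
      by (simp add: real_sqrt_mult[symmetric] abs_mult mult_ac)
    \<comment> \<open>The kernel carries \<open>norm h\<close>, which is at least the true
      denominator \<open>?r\<close>.\<close>
    have "sqrt \<bar>?c\<bar> * (sqrt \<bar>v \<bullet> h\<bar> * sqrt \<bar>w \<bullet> h\<bar>) / norm h \<le> sqrt (?r\<^sup>2 - (s * (w \<bullet> h))\<^sup>2) / ?r"
      by (rule frac_le[OF order_trans[OF _ le] le r norm_reject_le]) simp
    also have "\<dots> = sqrt ((?r\<^sup>2 - (s * (w \<bullet> h))\<^sup>2) / ?r\<^sup>2)"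
      using r by (simp add: real_sqrt_divide)
    also have "(?r\<^sup>2 - (s * (w \<bullet> h))\<^sup>2) / ?r\<^sup>2 = 1 - (y \<bullet> sgn (reject z h))\<^sup>2"
      using r by (simp add: reject_inner_frame[OF w(3,2)] power_divide diff_divide_distrib)
    finally show "sqrt \<bar>?c\<bar> * (sqrt \<bar>v \<bullet> h\<bar> * sqrt \<bar>w \<bullet> h\<bar>) / norm h
        \<le> sqrt (1 - (y \<bullet> sgn (reject z h))\<^sup>2)" .
  qed simp
qed

text \<open>A second direction \<open>u\<close> orthogonal to \<open>z\<close> and \<open>w\<close>
  replaces \<open>w\<close> in the mean inequality, so no factor \<open>y \<bullet> z\<close>
  appears.\<close>

lemma step_inverse_sine_bound_uniform:
  fixes y z :: 'a
  assumes "4 \<le> DIM('a)" "norm y = 1" "norm z = 1"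
  shows "(\<integral>\<^sup>+h. inverse (ennreal (sqrt (1 - (y \<bullet> sgn (reject z h))\<^sup>2))) \<partial>std_gauss) \<le> ennreal K"
proof -
  obtain w s where w: "norm w = 1" "w \<bullet> z = 0" "y = (y \<bullet> z) *\<^sub>R z + s *\<^sub>R w" "s\<^sup>2 = 1 - (y \<bullet> z)\<^sup>2"
    using orthonormal_frame[of y z] assms by auto
  obtain v u where vu: "norm v = 1" "norm u = 1" "v \<bullet> u = 0"
    "v \<bullet> w = 0" "v \<bullet> z = 0" "u \<bullet> w = 0" "u \<bullet> z = 0"
    using unit_orthogonal_pair[OF assms(1), of w z] by metis
  have "(\<integral>\<^sup>+h. inverse (ennreal (sqrt (1 - (y \<bullet> sgn (reject z h))\<^sup>2))) \<partial>std_gauss)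
      \<le> ennreal K * inverse (ennreal 1)"
  proof (rule nn_integral_inverse_bound[OF vu(1-3)])
    fix h assume vh: "v \<bullet> h \<noteq> 0"
    let ?r = "norm (reject z h)"
    have "v \<bullet> reject z h \<noteq> 0" using vh vu by (simp add: reject_inner)
    then have r: "0 < ?r" by auto
    have "v \<noteq> w" "u \<noteq> w" "v \<noteq> u" using vu w by auto
    moreover have "pairwise orthogonal {v, u, w}"
      using vu by (auto simp: pairwise_def orthogonal_def inner_commute)
    ultimately have "(v \<bullet> h)\<^sup>2 + (u \<bullet> h)\<^sup>2 + (w \<bullet> h)\<^sup>2 \<le> ?r\<^sup>2"
      using norm_reject_ge_frame[of "{v, u, w}" z h] vu w(1,2) by (auto simp: add.assoc)
    moreover have "(s * (w \<bullet> h))\<^sup>2 \<le> 1 * (w \<bullet> h)\<^sup>2"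
      unfolding power_mult_distrib by (intro mult_right_mono) (simp_all add: w(4))
    moreover have "0 \<le> (\<bar>v \<bullet> h\<bar> - \<bar>u \<bullet> h\<bar>)\<^sup>2" by simp
    then have "2 * (\<bar>v \<bullet> h\<bar> * \<bar>u \<bullet> h\<bar>) \<le> (v \<bullet> h)\<^sup>2 + (u \<bullet> h)\<^sup>2"
      by (simp add: power2_diff)
    moreover have "0 \<le> \<bar>v \<bullet> h\<bar> * \<bar>u \<bullet> h\<bar>" by simp
    ultimately have "\<bar>v \<bullet> h\<bar> * \<bar>u \<bullet> h\<bar> \<le> ?r\<^sup>2 - (s * (w \<bullet> h))\<^sup>2" by linarith
    then have le: "1 * (sqrt \<bar>v \<bullet> h\<bar> * sqrt \<bar>u \<bullet> h\<bar>) \<le> sqrt (?r\<^sup>2 - (s * (w \<bullet> h))\<^sup>2)"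
      by (simp add: real_sqrt_mult[symmetric])
    have "1 * (sqrt \<bar>v \<bullet> h\<bar> * sqrt \<bar>u \<bullet> h\<bar>) / norm h \<le> sqrt (?r\<^sup>2 - (s * (w \<bullet> h))\<^sup>2) / ?r"
      by (rule frac_le[OF order_trans[OF _ le] le r norm_reject_le]) simp
    also have "\<dots> = sqrt ((?r\<^sup>2 - (s * (w \<bullet> h))\<^sup>2) / ?r\<^sup>2)"
      using r by (simp add: real_sqrt_divide)
    also have "(?r\<^sup>2 - (s * (w \<bullet> h))\<^sup>2) / ?r\<^sup>2 = 1 - (y \<bullet> sgn (reject z h))\<^sup>2"
      using r by (simp add: reject_inner_frame[OF w(3,2)] power_divide diff_divide_distrib)
    finally show "1 * (sqrt \<bar>v \<bullet> h\<bar> * sqrt \<bar>u \<bullet> h\<bar>) / norm h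
        \<le> sqrt (1 - (y \<bullet> sgn (reject z h))\<^sup>2)" .
  qed simp
  then show ?thesis by simp
qed

text \<open>The cosine is singular only through \<open>w \<bullet> h\<close>, with coefficient
  \<open>s\<close>. The factor from \<open>v\<close> is padding that produces the kernel; it costs
  nothing since \<open>\<bar>v \<bullet> h\<bar>\<close> and the norm of the rejection are at most
  \<open>norm h\<close>.\<close>

lemma step_inverse_root_cosine_bound:
  fixes y z :: 'a
  assumes "3 \<le> DIM('a)" "norm y = 1" "norm z = 1"
  shows "(\<integral>\<^sup>+h. inverse (ennreal (sqrt \<bar>y \<bullet> sgn (reject z h)\<bar>)) \<partial>std_gauss)
    \<le> ennreal K * inverse (ennreal (sqrt (sqrt (1 - (y \<bullet> z)\<^sup>2))))"
proof -
  obtain w s where w: "norm w = 1" "w \<bullet> z = 0" "y = (y \<bullet> z) *\<^sub>R z + s *\<^sub>R w" "s\<^sup>2 = 1 - (y \<bullet> z)\<^sup>2"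
    using orthonormal_frame[of y z] assms by auto
  have s: "sqrt (1 - (y \<bullet> z)\<^sup>2) = \<bar>s\<bar>"
    by (simp flip: w(4))
  obtain v where v: "norm v = 1" "v \<bullet> w = 0" "v \<bullet> z = 0"
    using unit_orthogonal_two[OF assms(1)] by blast
  show ?thesis
    unfolding s
  proof (rule nn_integral_inverse_bound[OF v(1) w(1) v(2)])
    fix h assume vh: "v \<bullet> h \<noteq> 0"
    let ?r = "norm (reject z h)"
    have "v \<bullet> reject z h \<noteq> 0" using vh v by (simp add: reject_inner)
    then have r: "0 < ?r" by auto
    have h: "0 < norm h" using r norm_reject_le[of z h] by linarith
    have "\<bar>v \<bullet> h\<bar> \<le> norm h" using Cauchy_Schwarz_ineq2[of v h] v by simp
    then have "sqrt \<bar>v \<bullet> h\<bar> * sqrt ?r \<le> sqrt (norm h) * sqrt (norm h)"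
      using norm_reject_le[of z h] by (intro mult_mono) auto
    then have "sqrt \<bar>v \<bullet> h\<bar> * sqrt ?r \<le> norm h" by simp
    then have "sqrt \<bar>v \<bullet> h\<bar> / norm h \<le> 1 / sqrt ?r"
      using r h by (simp add: divide_simps mult.commute)
    then have "sqrt \<bar>s\<bar> * sqrt \<bar>w \<bullet> h\<bar> * (sqrt \<bar>v \<bullet> h\<bar> / norm h) \<le> sqrt \<bar>s\<bar> * sqrt \<bar>w \<bullet> h\<bar> * (1 / sqrt ?r)"
      by (intro mult_left_mono) auto
    also have "\<dots> = sqrt \<bar>y \<bullet> sgn (reject z h)\<bar>"
      by (simp add: reject_inner_frame[OF w(3,2)] abs_mult real_sqrt_mult real_sqrt_divide)
    finally show "sqrt \<bar>s\<bar> * (sqrt \<bar>v \<bullet> h\<bar> * sqrt \<bar>w \<bullet> h\<bar>) / norm h \<le> sqrt \<bar>y \<bullet> sgn (reject z h)\<bar>"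
      by (simp add: mult_ac)
  qed simp
qed

text \<open>The sine is at least \<open>\<bar>v \<bullet> h\<bar>\<close> over the norm of the
  rejection, whatever \<open>y\<close> and \<open>z\<close> are. The extra root makes this exponent
  integrable, and now \<open>w\<close> supplies the padding.\<close>

lemma step_inverse_root_sine_bound:
  fixes y z :: 'a
  assumes "3 \<le> DIM('a)" "norm y = 1" "norm z = 1"
  shows "(\<integral>\<^sup>+h. inverse (ennreal (sqrt (sqrt (1 - (y \<bullet> sgn (reject z h))\<^sup>2)))) \<partial>std_gauss) \<le> ennreal K"
proof -
  obtain w s where w: "norm w = 1" "w \<bullet> z = 0" "y = (y \<bullet> z) *\<^sub>R z + s *\<^sub>R w" "s\<^sup>2 = 1 - (y \<bullet> z)\<^sup>2"
    using orthonormal_frame[of y z] assms by auto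
  obtain v where v: "norm v = 1" "v \<bullet> w = 0" "v \<bullet> z = 0"
    using unit_orthogonal_two[OF assms(1)] by blast
  have "(\<integral>\<^sup>+h. inverse (ennreal (sqrt (sqrt (1 - (y \<bullet> sgn (reject z h))\<^sup>2)))) \<partial>std_gauss)
      \<le> ennreal K * inverse (ennreal 1)"
  proof (rule nn_integral_inverse_bound[OF v(1) w(1) v(2)])
    fix h assume vh: "v \<bullet> h \<noteq> 0"
    let ?r = "norm (reject z h)"
    have "v \<bullet> reject z h \<noteq> 0" using vh v by (simp add: reject_inner)
    then have r: "0 < ?r" by auto
    have h: "0 < norm h" using r norm_reject_le[of z h] by linarith
    have "v \<noteq> w" using v by auto
    moreover have "pairwise orthogonal {v, w}"
      using v by (auto simp: pairwise_def orthogonal_def inner_commute)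
    ultimately have "(v \<bullet> h)\<^sup>2 + (w \<bullet> h)\<^sup>2 \<le> ?r\<^sup>2"
      using norm_reject_ge_frame[of "{v, w}" z h] v w(1,2) by auto
    moreover have "(s * (w \<bullet> h))\<^sup>2 \<le> 1 * (w \<bullet> h)\<^sup>2"
      unfolding power_mult_distrib by (intro mult_right_mono) (simp_all add: w(4))
    ultimately have "(v \<bullet> h)\<^sup>2 \<le> ?r\<^sup>2 - (s * (w \<bullet> h))\<^sup>2" by linarith
    then have "(v \<bullet> h)\<^sup>2 / ?r\<^sup>2 \<le> (?r\<^sup>2 - (s * (w \<bullet> h))\<^sup>2) / ?r\<^sup>2"
      by (intro divide_right_mono) auto
    also have "\<dots> = 1 - (y \<bullet> sgn (reject z h))\<^sup>2"
      using r by (simp add: reject_inner_frame[OF w(3,2)] power_divide diff_divide_distrib)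
    finally have "sqrt (sqrt ((v \<bullet> h)\<^sup>2 / ?r\<^sup>2)) \<le> sqrt (sqrt (1 - (y \<bullet> sgn (reject z h))\<^sup>2))"
      by simp
    moreover have "sqrt (sqrt ((v \<bullet> h)\<^sup>2 / ?r\<^sup>2)) = sqrt \<bar>v \<bullet> h\<bar> * (1 / sqrt ?r)"
      by (simp add: real_sqrt_divide)
    moreover have "sqrt \<bar>w \<bullet> h\<bar> / norm h \<le> 1 / sqrt ?r"
    proof -
      have "\<bar>w \<bullet> h\<bar> \<le> norm h" using Cauchy_Schwarz_ineq2[of w h] w by simp
      then have "sqrt \<bar>w \<bullet> h\<bar> * sqrt ?r \<le> sqrt (norm h) * sqrt (norm h)"
        using norm_reject_le[of z h] by (intro mult_mono) auto
      then have "sqrt \<bar>w \<bullet> h\<bar> * sqrt ?r \<le> norm h" by simp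
      then show ?thesis using r h by (simp add: divide_simps mult.commute)
    qed
    then have "sqrt \<bar>v \<bullet> h\<bar> * (sqrt \<bar>w \<bullet> h\<bar> / norm h) \<le> sqrt \<bar>v \<bullet> h\<bar> * (1 / sqrt ?r)"
      by (intro mult_left_mono) auto
    ultimately show "1 * (sqrt \<bar>v \<bullet> h\<bar> * sqrt \<bar>w \<bullet> h\<bar>) / norm h
        \<le> sqrt (sqrt (1 - (y \<bullet> sgn (reject z h))\<^sup>2))"
      by simp
  qed simp
  then show ?thesis by simp
qed

end

lemma AE_std_gauss_reject_neq_0:
  fixes a :: "'a::euclidean_space"
  assumes "2 \<le> DIM('a)"
  shows "AE h in std_gauss. reject a h \<noteq> 0"
proof -
  obtain w where w: "norm w = 1" "w \<bullet> a = 0"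
    using unit_orthogonal_exists[of "{a}"] assms by auto
  then have "AE h in std_gauss. w \<bullet> h \<noteq> 0"
    by (intro AE_std_gauss_inner_neq_0) auto
  then show ?thesis
  proof (rule eventually_mono)
    show "reject a h \<noteq> 0" if "w \<bullet> h \<noteq> 0" for h
      using that reject_inner[OF w(2), of h] by auto
  qed
qed

section \<open>Random walks with orthogonal steps\<close>

abbreviation gauss_prod :: "nat \<Rightarrow> (nat \<Rightarrow> 'a::euclidean_space) measure" where
  "gauss_prod k \<equiv> PiM {0..<k} (\<lambda>_. std_gauss)"

lemma prob_space_gauss_prod: "prob_space (gauss_prod k :: (nat \<Rightarrow> 'a::euclidean_space) measure)"
  by (intro prob_space_PiM prob_space_std_gauss)

lemma gauss_prod_component_measurable [measurable]:
  assumes "v < k"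
  shows "(\<lambda>g. g v) \<in> borel_measurable (gauss_prod k :: (nat \<Rightarrow> 'a::euclidean_space) measure)"
proof -
  have "(\<lambda>g. g v) \<in> measurable (gauss_prod k :: (nat \<Rightarrow> 'a) measure) std_gauss"
    using assms by (intro measurable_component_singleton) simp
  then show ?thesis by (simp add: measurable_cong_sets[OF refl sets_std_gauss])
qed

text \<open>Fubini in coordinate \<open>v\<close>: an independent copy may replace it. This is how
  conditioning on the other coordinates is expressed.\<close>

lemma nn_integral_gauss_prod_resample:
  fixes H :: "(nat \<Rightarrow> 'a::euclidean_space) \<Rightarrow> ennreal"
  assumes "v < k" and H: "H \<in> borel_measurable (gauss_prod k)"
  shows "(\<integral>\<^sup>+g. H g \<partial>gauss_prod k) = (\<integral>\<^sup>+g. (\<integral>\<^sup>+h. H (g(v := h)) \<partial>std_gauss) \<partial>gauss_prod k)"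
proof -
  interpret gauss: prob_space "std_gauss :: 'a measure" by (rule prob_space_std_gauss)
  interpret product_sigma_finite "\<lambda>_::nat. std_gauss :: 'a measure" by standard
  let ?I = "{0..<k} - {v}"
  have ins: "insert v ?I = {0..<k}" using assms by auto
  have split: "(\<integral>\<^sup>+g. F g \<partial>gauss_prod k) = (\<integral>\<^sup>+g. (\<integral>\<^sup>+h. F (g(v := h)) \<partial>std_gauss) \<partial>PiM ?I (\<lambda>_. std_gauss))"
    if "F \<in> borel_measurable (gauss_prod k)" for F :: "(nat \<Rightarrow> 'a) \<Rightarrow> ennreal"
    using product_nn_integral_insert[of ?I v F] that unfolding ins by simp
  have upd: "(\<lambda>(g, h). g(v := h)) \<in> measurable (gauss_prod k \<Otimes>\<^sub>M std_gauss) (gauss_prod k :: (nat \<Rightarrow> 'a) measure)"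
    using measurable_add_dim[of v "{0..<k}" "\<lambda>_. std_gauss"] assms by (simp add: insert_absorb)
  have "(\<lambda>x. H (case x of (g, h) \<Rightarrow> g(v := h))) \<in> borel_measurable (gauss_prod k \<Otimes>\<^sub>M std_gauss)"
    using upd H by (rule measurable_compose)
  then have "(\<lambda>g. \<integral>\<^sup>+h. H (g(v := h)) \<partial>std_gauss) \<in> borel_measurable (gauss_prod k)"
    by (intro gauss.borel_measurable_nn_integral) (simp add: case_prod_beta)
  \<comment> \<open>Splitting the right-hand side integrates over coordinate \<open>v\<close> twice;
    the inner update overwrites the outer one, whose integral has mass 1.\<close>
  from split[OF this] split[OF H] show ?thesis
    by (simp add: gauss.emeasure_space_1)
qed

lemma AE_gauss_prod_resample:
  fixes Q :: "(nat \<Rightarrow> 'a::euclidean_space) \<Rightarrow> bool"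
  assumes "v < k" and [measurable]: "Measurable.pred (gauss_prod k) Q"
    and AE: "\<And>g. AE h in std_gauss. Q (g(v := h))"
  shows "AE g in gauss_prod k. Q g"
proof -
  let ?H = "\<lambda>g. indicator {g. \<not> Q g} g :: ennreal"
  have [measurable]: "?H \<in> borel_measurable (gauss_prod k)"
    by (simp add: indicator_def)
  have "(\<integral>\<^sup>+h. ?H (g(v := h)) \<partial>std_gauss) = 0" for g
    using AE[of g] by (subst nn_integral_cong_AE[where v = "\<lambda>_. 0"]) (auto elim!: eventually_mono simp: indicator_def)
  then have "(\<integral>\<^sup>+g. ?H g \<partial>gauss_prod k) = 0"
    by (subst nn_integral_gauss_prod_resample[OF assms(1)]) auto
  then have "AE g in gauss_prod k. ?H g = 0"
    by (subst (asm) nn_integral_0_iff_AE) auto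
  then show ?thesis by (auto elim!: eventually_mono simp: indicator_def split: if_splits)
qed

text \<open>The positions \<open>seq_ortho\<close> gives to all vertices of the cycle but the last,
  as a recursion in the Gaussian drivers; see \<open>seq_ortho_cycle_walk\<close>.\<close>

fun walk :: "(nat \<Rightarrow> 'a::euclidean_space) \<Rightarrow> nat \<Rightarrow> 'a" where
  "walk g 0 = sgn (g 0)"
| "walk g (Suc m) = sgn (reject (walk g m) (g (Suc m)))"

lemma walk_fun_upd: "v < i \<Longrightarrow> walk (g(i := h)) v = walk g v"
  by (induction v) auto

lemma walk_fun_upd_Suc: "walk (g(Suc m := h)) (Suc m) = sgn (reject (walk g m) h)"
  by (simp add: walk_fun_upd)

lemma walk_orthogonal: "walk g m \<bullet> walk g (Suc m) = 0"
  using reject_orthogonal[of "walk g m" "g (Suc m)"]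
  by (simp add: sgn_div_norm inner_commute)

lemma walk_measurable [measurable]:
  "v < k \<Longrightarrow> (\<lambda>g. walk g v) \<in> borel_measurable (gauss_prod k :: (nat \<Rightarrow> 'a::euclidean_space) measure)"
  by (induction v) auto

lemma AE_norm_walk:
  assumes "2 \<le> DIM('a::euclidean_space)" "v < k"
  shows "AE g in (gauss_prod k :: (nat \<Rightarrow> 'a) measure). norm (walk g v) = 1"
proof (rule AE_gauss_prod_resample[OF assms(2)])
  show "Measurable.pred (gauss_prod k :: (nat \<Rightarrow> 'a) measure) (\<lambda>g. norm (walk g v) = 1)"
    using assms(2) by measurable
  fix g :: "nat \<Rightarrow> 'a"
  show "AE h in std_gauss. norm (walk (g(v := h)) v) = 1"
  proof (cases v)
    case 0
    \<comment> \<open>As \<open>reject 0 h = h\<close>, this says that the first driver is almost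
      surely nonzero.\<close>
    have "AE h in std_gauss. reject (0::'a) h \<noteq> 0"
      by (rule AE_std_gauss_reject_neq_0[OF assms(1)])
    then show ?thesis
      by (rule eventually_mono) (simp add: 0 reject_def norm_sgn)
  next
    case (Suc m)
    have "AE h in std_gauss. reject (walk g m) h \<noteq> 0"
      by (rule AE_std_gauss_reject_neq_0[OF assms(1)])
    then show ?thesis
      unfolding Suc walk_fun_upd_Suc by (rule eventually_mono) (simp add: norm_sgn)
  qed
qed

text \<open>The positions \<open>y\<close> and \<open>z\<close> do not depend on the driver of the
  last step, so resampling that driver puts the one-step bound inside the outer integral.\<close>

lemma nn_integral_walk_step:
  fixes \<Phi> \<Psi> :: "'a::euclidean_space \<Rightarrow> 'a \<Rightarrow> ennreal"
  assumes "2 \<le> DIM('a)" "Suc m < k"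
    and meas: "(\<lambda>g. \<Phi> (walk g 0) (walk g (Suc m))) \<in> borel_measurable (gauss_prod k)"
    and le: "\<And>y z. norm y = 1 \<Longrightarrow> norm z = 1 \<Longrightarrow> (\<integral>\<^sup>+h. \<Phi> y (sgn (reject z h)) \<partial>std_gauss) \<le> \<Psi> y z"
  shows "(\<integral>\<^sup>+g. \<Phi> (walk g 0) (walk g (Suc m)) \<partial>gauss_prod k) \<le> (\<integral>\<^sup>+g. \<Psi> (walk g 0) (walk g m) \<partial>gauss_prod k)"
proof -
  have "(\<integral>\<^sup>+g. \<Phi> (walk g 0) (walk g (Suc m)) \<partial>gauss_prod k) =
      (\<integral>\<^sup>+g. (\<integral>\<^sup>+h. \<Phi> (walk g 0) (sgn (reject (walk g m) h)) \<partial>std_gauss) \<partial>gauss_prod k)"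
    by (subst nn_integral_gauss_prod_resample[OF assms(2) meas])
      (simp only: walk_fun_upd_Suc walk_fun_upd[OF zero_less_Suc])
  also have "\<dots> \<le> (\<integral>\<^sup>+g. \<Psi> (walk g 0) (walk g m) \<partial>gauss_prod k)"
  proof (rule nn_integral_mono_AE)
    have "AE g in (gauss_prod k :: (nat \<Rightarrow> 'a) measure). norm (walk g 0) = 1"
      "AE g in (gauss_prod k :: (nat \<Rightarrow> 'a) measure). norm (walk g m) = 1"
      using assms by (auto intro!: AE_norm_walk simp del: walk.simps)
    then show "AE g in gauss_prod k. (\<integral>\<^sup>+h. \<Phi> (walk g 0) (sgn (reject (walk g m) h)) \<partial>std_gauss)
        \<le> \<Psi> (walk g 0) (walk g m)"
      by eventually_elim (rule le)
  qed
  finally show ?thesis .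
qed

text \<open>For \<open>k = 4\<close> the last step starts orthogonally to \<open>walk g 0\<close>,
  where \<open>step_inverse_sine_bound\<close> has an infinite right-hand factor; hence the uniform
  bound and dimension 4. For \<open>k \<ge> 5\<close> the one-step bounds are chained
  backwards.\<close>

lemma nn_integral_walk_inverse_sine_finite:
  assumes dim: "3 \<le> DIM('a::euclidean_space)" and "3 \<le> k" and "4 \<le> DIM('a) \<or> k \<noteq> 4"
  shows "(\<integral>\<^sup>+g. inverse (ennreal (sqrt (1 - (walk g 0 \<bullet> walk g (k - 2))\<^sup>2)))
    \<partial>(gauss_prod k :: (nat \<Rightarrow> 'a) measure)) < top"
proof -
  interpret P: prob_space "gauss_prod k :: (nat \<Rightarrow> 'a) measure" by (rule prob_space_gauss_prod)
  have dim2: "2 \<le> DIM('a)" using dim by simp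
  obtain K where "\<And>v w :: 'a. norm v = 1 \<Longrightarrow> norm w = 1 \<Longrightarrow> v \<bullet> w = 0 \<Longrightarrow>
      (\<integral>\<^sup>+h. gauss_kernel v w h \<partial>std_gauss) \<le> ennreal K"
    using nn_integral_gauss_kernel_bound[OF dim2] by blast
  then interpret gauss_kernel_bound K "TYPE('a)" by unfold_locales
  let ?P = "gauss_prod k :: (nat \<Rightarrow> 'a) measure"
  note walk.simps [simp del]
  \<comment> \<open>Writing \<open>k = n + 5\<close> makes \<open>k - 2\<close> equal to
    \<open>Suc (Suc (Suc n))\<close>, so three steps can be undone.\<close>
  consider "k = 3" | "k = 4" | n where "k = n + 5"
  proof -
    have "k = 3 \<or> k = 4 \<or> k = (k - 5) + 5" using assms(2) by linarith
    then show thesis using that by blast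
  qed
  then show ?thesis
  proof cases
    case 1
    then have "walk g 0 \<bullet> walk g (k - 2) = 0" for g :: "nat \<Rightarrow> 'a"
      using walk_orthogonal[of g 0] by simp
    then show ?thesis by (simp add: P.emeasure_space_1)
  next
    case 2
    then have dim4: "4 \<le> DIM('a)" and k: "k - 2 = Suc 1" using assms by auto
    have [measurable]: "(\<lambda>g. walk g 0) \<in> borel_measurable ?P" "(\<lambda>g. walk g (Suc 1)) \<in> borel_measurable ?P"
      using 2 by (auto intro!: walk_measurable)
    have "(\<integral>\<^sup>+g. inverse (ennreal (sqrt (1 - (walk g 0 \<bullet> walk g (Suc 1))\<^sup>2))) \<partial>?P) \<le> (\<integral>\<^sup>+g. ennreal K \<partial>?P)"
      using 2 by (intro nn_integral_walk_step[where \<Psi> = "\<lambda>_ _. ennreal K"] dim2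
          step_inverse_sine_bound_uniform dim4) (simp, measurable)
    also have "\<dots> < top" by (simp add: P.emeasure_space_1)
    finally show ?thesis unfolding k .
  next
    case 3
    then have k: "k - 2 = Suc (Suc (Suc n))" by simp
    have m: "(\<lambda>g. walk g v) \<in> borel_measurable ?P" if "v \<le> Suc (Suc (Suc n))" for v
      using that 3 by (intro walk_measurable) simp
    note [measurable] = m[of 0, simplified] m[of n, simplified] m[of "Suc n", simplified]
      m[of "Suc (Suc n)", simplified] m[of "Suc (Suc (Suc n))", simplified]
    have "(\<integral>\<^sup>+g. inverse (ennreal (sqrt (1 - (walk g 0 \<bullet> walk g (Suc (Suc (Suc n))))\<^sup>2))) \<partial>?P)
        \<le> (\<integral>\<^sup>+g. ennreal K * inverse (ennreal (sqrt \<bar>walk g 0 \<bullet> walk g (Suc (Suc n))\<bar>)) \<partial>?P)"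
      using 3 by (intro nn_integral_walk_step[where \<Psi> = "\<lambda>y z. ennreal K * inverse (ennreal (sqrt \<bar>y \<bullet> z\<bar>))"]
          dim2 step_inverse_sine_bound dim) (simp, measurable)
    also have "\<dots> = ennreal K * (\<integral>\<^sup>+g. inverse (ennreal (sqrt \<bar>walk g 0 \<bullet> walk g (Suc (Suc n))\<bar>)) \<partial>?P)"
      by (rule nn_integral_cmult) measurable
    also have "(\<integral>\<^sup>+g. inverse (ennreal (sqrt \<bar>walk g 0 \<bullet> walk g (Suc (Suc n))\<bar>)) \<partial>?P)
        \<le> (\<integral>\<^sup>+g. ennreal K * inverse (ennreal (sqrt (sqrt (1 - (walk g 0 \<bullet> walk g (Suc n))\<^sup>2)))) \<partial>?P)"
      using 3 by (intro nn_integral_walk_step[where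
            \<Phi> = "\<lambda>y z. inverse (ennreal (sqrt \<bar>y \<bullet> z\<bar>))" and
            \<Psi> = "\<lambda>y z. ennreal K * inverse (ennreal (sqrt (sqrt (1 - (y \<bullet> z)\<^sup>2))))"]
          dim2 step_inverse_root_cosine_bound dim) (simp, measurable)
    also have "\<dots> = ennreal K * (\<integral>\<^sup>+g. inverse (ennreal (sqrt (sqrt (1 - (walk g 0 \<bullet> walk g (Suc n))\<^sup>2)))) \<partial>?P)"
      by (rule nn_integral_cmult) measurable
    also have "(\<integral>\<^sup>+g. inverse (ennreal (sqrt (sqrt (1 - (walk g 0 \<bullet> walk g (Suc n))\<^sup>2)))) \<partial>?P) \<le> ennreal (max 1 K)"
    \<comment> \<open>For \<open>n = 0\<close> the positions are orthogonal and the integral is 1;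
      otherwise one more step gives \<open>K\<close>.\<close>
    proof (cases n)
      case 0
      then show ?thesis
        by (simp add: walk_orthogonal P.emeasure_space_1 max_def)
    next
      case (Suc n')
      have "(\<integral>\<^sup>+g. inverse (ennreal (sqrt (sqrt (1 - (walk g 0 \<bullet> walk g (Suc n))\<^sup>2)))) \<partial>?P) \<le> (\<integral>\<^sup>+g. ennreal K \<partial>?P)"
        using 3 by (intro nn_integral_walk_step[where
            \<Phi> = "\<lambda>y z. inverse (ennreal (sqrt (sqrt (1 - (y \<bullet> z)\<^sup>2))))" and
            \<Psi> = "\<lambda>_ _. ennreal K"]
            dim2 step_inverse_root_sine_bound dim) (simp, measurable)
      also have "\<dots> \<le> ennreal (max 1 K)" by (simp add: P.emeasure_space_1 ennreal_leI)
      finally show ?thesis .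
    qed
    finally have "(\<integral>\<^sup>+g. inverse (ennreal (sqrt (1 - (walk g 0 \<bullet> walk g (Suc (Suc (Suc n))))\<^sup>2))) \<partial>?P)
        \<le> ennreal K * (ennreal K * ennreal (max 1 K))"
      by (simp add: mult_left_mono)
    also have "\<dots> < top" by (simp add: ennreal_mult_less_top)
    finally show ?thesis unfolding k .
  qed
qed

section \<open>Cycles\<close>

lemma back_nbrs_cycle_0: "3 \<le> k \<Longrightarrow> back_nbrs k (cycle_graph k) Suc 0 = {}"
  by (auto simp: back_nbrs_def)

lemma back_nbrs_cycle_middle:
  assumes "3 \<le> k" "0 < v" "v < k - 1"
  shows "back_nbrs k (cycle_graph k) Suc v = {v - 1}"
proof -
  have "cycle_graph k v w \<longleftrightarrow> w = v - 1" if "w < v" for w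
  proof -
    have "(v + 1) mod k = v + 1" "(w + 1) mod k = w + 1" using that assms by auto
    then show ?thesis using that assms by (auto simp: cycle_graph_def)
  qed
  then show ?thesis using assms by (auto simp: back_nbrs_def)
qed

text \<open>The wrap-around of \<open>mod\<close> adds the neighbour 0, which differs from
  \<open>k - 2\<close> as \<open>k \<ge> 3\<close>.\<close>

lemma back_nbrs_cycle_last:
  assumes "3 \<le> k"
  shows "back_nbrs k (cycle_graph k) Suc (k - 1) = {0, k - 2}"
proof -
  have "cycle_graph k (k - 1) w \<longleftrightarrow> w = 0 \<or> w = k - 2" if "w < k - 1" for w
  proof -
    have "(k - 1 + 1) mod k = 0" "(w + 1) mod k = w + 1" using that assms by auto
    then show ?thesis using that assms by (auto simp: cycle_graph_def)
  qed
  then show ?thesis using assms by (auto simp: back_nbrs_def)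
qed

text \<open>Under the ordering \<open>Suc\<close>, step \<open>Suc m\<close> places vertex
  \<open>m\<close>.\<close>

lemma seq_ortho_Suc:
  assumes "m < k"
  shows "seq_ortho k E Suc g (Suc m) = (seq_ortho k E Suc g m)
    (m := sgn (perp_proj (seq_ortho k E Suc g m ` back_nbrs k E Suc m) (g m)))"
proof -
  have "inv_into {0..<k} Suc (Suc m) = m"
    using assms by (intro inv_into_f_f) auto
  then show ?thesis by (simp add: Let_def)
qed

text \<open>With \<open>m \<le> k - 1\<close> the last vertex is still unplaced, so each projection
  is the identity or a single \<open>reject\<close>.\<close>

lemma seq_ortho_cycle_walk:
  assumes "3 \<le> k" "m \<le> k - 1" "v < m"
  shows "seq_ortho k (cycle_graph k) Suc g m v = walk g v"
  using assms(2,3)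
proof (induction m arbitrary: v)
  case (Suc m)
  note IH = Suc.IH and prems = Suc.prems
  have m: "m < k" using prems assms(1) by simp
  show ?case
  proof (cases "v = m")
    case True
    show ?thesis
    proof (cases m)
      case 0
      then show ?thesis
        using True seq_ortho_Suc[OF m, of "cycle_graph k" g] assms(1)
        by (simp add: back_nbrs_cycle_0 perp_proj_empty del: seq_ortho.simps)
    next
      case (Suc l)
      have "back_nbrs k (cycle_graph k) Suc m = {l}"
        using back_nbrs_cycle_middle[OF assms(1), of m] Suc prems by simp
      moreover have "seq_ortho k (cycle_graph k) Suc g m l = walk g l"
        using IH[of l] Suc prems by simp
      ultimately show ?thesis
        using True Suc seq_ortho_Suc[OF m, of "cycle_graph k" g]
        by (simp add: perp_proj_singleton del: seq_ortho.simps)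
    qed
  next
    case False
    then show ?thesis
      using IH prems seq_ortho_Suc[OF m, of "cycle_graph k" g] by (simp del: seq_ortho.simps)
  qed
qed simp

lemma seq_ortho_cycle:
  assumes "3 \<le> k"
  shows "v < k - 1 \<Longrightarrow> seq_ortho k (cycle_graph k) Suc g k v = walk g v"
    and "seq_ortho k (cycle_graph k) Suc g k (k - 1) =
      sgn (reject (reject (walk g 0) (walk g (k - 2))) (reject (walk g 0) (g (k - 1))))"
proof -
  let ?X = "seq_ortho k (cycle_graph k) Suc g (k - 1)"
  have img: "?X ` {0, k - 2} = {walk g 0, walk g (k - 2)}"
    using assms by (simp add: seq_ortho_cycle_walk del: walk.simps)
  have "seq_ortho k (cycle_graph k) Suc g (Suc (k - 1)) = ?X
      (k - 1 := sgn (reject (reject (walk g 0) (walk g (k - 2))) (reject (walk g 0) (g (k - 1)))))"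
    using assms by (subst seq_ortho_Suc) (simp, simp only: back_nbrs_cycle_last img perp_proj_doubleton)
  then have last: "seq_ortho k (cycle_graph k) Suc g k = ?X
      (k - 1 := sgn (reject (reject (walk g 0) (walk g (k - 2))) (reject (walk g 0) (g (k - 1)))))"
    using assms by (simp del: seq_ortho.simps walk.simps)
  show "v < k - 1 \<Longrightarrow> seq_ortho k (cycle_graph k) Suc g k v = walk g v"
    unfolding last using assms by (simp add: seq_ortho_cycle_walk del: walk.simps)
  show "seq_ortho k (cycle_graph k) Suc g k (k - 1) =
      sgn (reject (reject (walk g 0) (walk g (k - 2))) (reject (walk g 0) (g (k - 1))))"
    unfolding last by simp
qed

text \<open>\<open>perp_proj\<close> is a definite description, so measurability is read off the
  explicit formulas of \<open>seq_ortho_cycle\<close>.\<close>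

lemma seq_ortho_cycle_measurable:
  assumes "3 \<le> k"
  shows "(\<lambda>g. restrict (seq_ortho k (cycle_graph k) Suc g k) {0..<k})
    \<in> measurable (gauss_prod k :: (nat \<Rightarrow> 'a::euclidean_space) measure) (PiM {0..<k} (\<lambda>_. borel))"
proof (rule measurable_restrict)
  fix v assume v: "v \<in> {0..<k}"
  show "(\<lambda>g. seq_ortho k (cycle_graph k) Suc g k v) \<in> borel_measurable (gauss_prod k :: (nat \<Rightarrow> 'a) measure)"
  proof (cases "v = k - 1")
    case True
    have [measurable]: "(\<lambda>g. walk g 0) \<in> borel_measurable (gauss_prod k :: (nat \<Rightarrow> 'a) measure)"
      "(\<lambda>g. walk g (k - 2)) \<in> borel_measurable (gauss_prod k :: (nat \<Rightarrow> 'a) measure)"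
      "(\<lambda>g. g (k - 1)) \<in> borel_measurable (gauss_prod k :: (nat \<Rightarrow> 'a) measure)"
      using assms by (auto intro!: walk_measurable gauss_prod_component_measurable simp del: walk.simps)
    show ?thesis
      unfolding True seq_ortho_cycle(2)[OF assms] by measurable
  next
    case False
    then have "v < k - 1" using v by auto
    then show ?thesis using v by (simp add: seq_ortho_cycle(1)[OF assms] walk_measurable)
  qed
qed

section \<open>Reduction of the density to the inverse sine\<close>

lemma Det_measurable:
  fixes I :: "'b set"
  assumes "finite N" "N \<subseteq> I"
  shows "Det N \<in> borel_measurable (PiM I (\<lambda>_. borel :: 'a::euclidean_space measure))"
proof -
  have [measurable]: "(\<lambda>x. x i) \<in> borel_measurable (PiM I (\<lambda>_. borel :: 'a measure))" if "i \<in> N" for i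
    using that assms by (intro measurable_component_singleton) auto
  have "(\<lambda>x. \<Prod>i\<in>N. x i \<bullet> x (\<sigma> i)) \<in> borel_measurable (PiM I (\<lambda>_. borel :: 'a measure))"
    if "\<sigma> permutes N" for \<sigma>
    using that by (intro borel_measurable_prod borel_measurable_inner) (auto simp: permutes_in_image)
  then have [measurable]: "gram_det N \<in> borel_measurable (PiM I (\<lambda>_. borel :: 'a measure))"
    unfolding gram_det_def
    by (intro borel_measurable_sum borel_measurable_times borel_measurable_const) auto
  show ?thesis unfolding Det_def by measurable
qed

text \<open>The Gram determinant of the empty family or of one unit vector is 1, so only the factor
  of vertex \<open>k - 1\<close> remains.\<close>

lemma cycle_integrand:
  fixes x :: "nat \<Rightarrow> 'a::euclidean_space" and A :: "nat \<Rightarrow> ennreal"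
  assumes "3 \<le> k" and unit: "\<And>v. v < k - 1 \<Longrightarrow> norm (x v) = 1"
  shows "(\<Prod>v\<in>{0..<k}. A v / ennreal (Det (back_nbrs k (cycle_graph k) Suc v) x)) =
    (\<Prod>v\<in>{0..<k}. A v) * inverse (ennreal (sqrt (1 - (x 0 \<bullet> x (k - 2))\<^sup>2)))"
proof -
  let ?D = "\<lambda>v. inverse (ennreal (Det (back_nbrs k (cycle_graph k) Suc v) x))"
  have D: "?D v = 1" if "v \<in> {0..<k} - {k - 1}" for v
  proof (cases "v = 0")
    case True
    then show ?thesis using assms by (simp add: back_nbrs_cycle_0 Det_def gram_det_def)
  next
    case False
    moreover have "v < k - 1" using that by auto
    ultimately show ?thesis
      using assms by (simp add: back_nbrs_cycle_middle Det_def gram_det_singleton)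
  qed
  have "(\<Prod>v\<in>{0..<k}. ?D v) = (\<Prod>v\<in>{k - 1}. ?D v)"
    using assms(1) by (intro prod.mono_neutral_right ballI D) auto
  also have "\<dots> = inverse (ennreal (sqrt (1 - (x 0 \<bullet> x (k - 2))\<^sup>2)))"
    using assms back_nbrs_cycle_last[of k] by (simp add: Det_def gram_det_doubleton)
  finally show ?thesis by (simp add: divide_ennreal_def prod.distrib)
qed

text \<open>\<open>rho\<close> is a push-forward, so the integral is taken over the drivers, where
  the integrand is almost surely a finite constant times the inverse sine.\<close>

lemma ortho_density_cycle_finite:
  assumes "3 \<le> DIM('a::euclidean_space)" "3 \<le> k" "4 \<le> DIM('a) \<or> k \<noteq> 4"
  shows "ortho_density TYPE('a) k (cycle_graph k) < top"
proof -
  define c where "c = ennreal (sphere_area (DIM('a) - 1) powr (real (num_edges k (cycle_graph k)) - real k)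
      / sphere_area (DIM('a) - 2) ^ num_edges k (cycle_graph k))"
  define A where "A v = ennreal (sphere_area (DIM('a) - card (back_nbrs k (cycle_graph k) Suc v) - 1))" for v
  let ?P = "gauss_prod k :: (nat \<Rightarrow> 'a) measure"
  let ?X = "\<lambda>g. restrict (seq_ortho k (cycle_graph k) Suc g k) {0..<k} :: nat \<Rightarrow> 'a"
  let ?D = "\<lambda>x. \<Prod>v\<in>{0..<k}. A v / ennreal (Det (back_nbrs k (cycle_graph k) Suc v) x)"
  let ?S = "\<lambda>g :: nat \<Rightarrow> 'a. inverse (ennreal (sqrt (1 - (walk g 0 \<bullet> walk g (k - 2))\<^sup>2)))"
  have [measurable]: "(\<lambda>x. Det (back_nbrs k (cycle_graph k) Suc v) x)
      \<in> borel_measurable (PiM {0..<k} (\<lambda>_. borel :: 'a measure))" for v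
    by (rule Det_measurable) (auto simp: back_nbrs_def)
  have [measurable]: "(\<lambda>g. walk g 0) \<in> borel_measurable ?P" "(\<lambda>g. walk g (k - 2)) \<in> borel_measurable ?P"
    using assms by (auto intro!: walk_measurable simp del: walk.simps)
  have unit: "AE g in ?P. \<forall>v\<in>{0..<k}. norm (walk g v) = 1"
    using assms by (intro AE_finite_allI AE_norm_walk) auto
  have "ortho_density TYPE('a) k (cycle_graph k) = (\<integral>\<^sup>+x. c * ?D x \<partial>rho TYPE('a) k (cycle_graph k) Suc)"
    by (simp add: ortho_density_def ortho_density_ord_def c_def A_def Let_def)
  also have "\<dots> = (\<integral>\<^sup>+g. c * ?D (?X g) \<partial>?P)"
    unfolding rho_def
    by (intro nn_integral_distr seq_ortho_cycle_measurable assms) measurable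
  also have "\<dots> = (\<integral>\<^sup>+g. c * (\<Prod>v\<in>{0..<k}. A v) * ?S g \<partial>?P)"
  proof (rule nn_integral_cong_AE)
    show "AE g in ?P. c * ?D (?X g) = c * (\<Prod>v\<in>{0..<k}. A v) * ?S g"
      using unit
    proof eventually_elim
      fix g :: "nat \<Rightarrow> 'a" assume g: "\<forall>v\<in>{0..<k}. norm (walk g v) = 1"
      have X: "?X g v = walk g v" if "v < k - 1" for v
      proof -
        have "v \<in> {0..<k}" using that by simp
        then show ?thesis using seq_ortho_cycle(1)[OF assms(2) that, of g] by simp
      qed
      have "?D (?X g) = (\<Prod>v\<in>{0..<k}. A v) * inverse (ennreal (sqrt (1 - (?X g 0 \<bullet> ?X g (k - 2))\<^sup>2)))"
        using g X by (intro cycle_integrand assms) (simp del: walk.simps restrict_apply)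
      also have "?X g 0 = walk g 0"
        using assms(2) by (intro X) simp
      also have "?X g (k - 2) = walk g (k - 2)"
        using assms(2) by (intro X) simp
      finally show "c * ?D (?X g) = c * (\<Prod>v\<in>{0..<k}. A v) * ?S g"
        by (simp only: mult.assoc)
    qed
  qed
  also have "\<dots> = c * (\<Prod>v\<in>{0..<k}. A v) * (\<integral>\<^sup>+g. ?S g \<partial>?P)"
    by (rule nn_integral_cmult) measurable
  also have "\<dots> < top"
    using nn_integral_walk_inverse_sine_finite[OF assms]
    by (simp add: ennreal_mult_less_top c_def A_def prod_ennreal ennreal_prod_eq_top less_top[symmetric]
        ennreal_mult_eq_top_iff)
  finally show ?thesis .
qed

theorem theorem20:
  fixes k :: nat
  assumes "CARD('d::finite) \<ge> 3" and "k \<ge> 3" and "(CARD('d), k) \<noteq> (3, 4)"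
  shows "ortho_density TYPE(real^'d) k (cycle_graph k) < \<infinity>"
  using ortho_density_cycle_finite[where 'a = "real^'d" and k = k] assms by auto

end
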